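(* Let $K\subset\mathbb{C}$ be a compact set with connected complement $\mathbb{C}\setminus K$, let $f\in A(K)$ and $\varepsilon>0$. Then there exists a Dirichlet polynomial $P(s)=\sum_{n=1}^{N}a_n\frac{1}{n^s}$ such that $\|f-P\|_{C(K)}<\varepsilon$.
   Context: For compact $K\subset\mathbb{C}$, $A(K)$ is the set of functions $K\to\mathbb{C}$ that are continuous on $K$ and holomorphic on the interior of $K$, and $\|\cdot\|_{C(K)}$ is the supremum norm on $K$. A Dirichlet polynomial is a finite sum $\sum_{n=1}^{N}a_n\frac{1}{n^s}$ with $a_n\in\mathbb{C}$. *)

theory Defs
  imports "HOL-Analysis.Analysis"
begin

text \<open>Functions on \<open>K\<close> are represented by total functions on \<open>\<complex>\<close>; only their values on \<open>K\<close> matter.\<close>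

definition A_space :: "complex set \<Rightarrow> (complex \<Rightarrow> complex) set" where
  "A_space K = {f. continuous_on K f \<and> f holomorphic_on interior K}"

text \<open>Inserting \<open>0\<close> changes nothing for nonempty \<open>K\<close>; it makes the norm \<open>0\<close> on the empty
  set, where \<open>Sup {}\<close> is unspecified on the reals. The value is meaningful only for functions
  bounded on \<open>K\<close>, in particular continuous functions on compact \<open>K\<close>.\<close>

definition sup_norm_on :: "complex set \<Rightarrow> (complex \<Rightarrow> complex) \<Rightarrow> real" where
  "sup_norm_on K g = Sup (insert 0 ((\<lambda>z. norm (g z)) ` K))"

definition dirichlet_poly :: "nat \<Rightarrow> (nat \<Rightarrow> complex) \<Rightarrow> complex \<Rightarrow> complex" where
  "dirichlet_poly N a s = (\<Sum>n=1..N. a n * (1 / of_nat n powr s))"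

end

theory Submission
  imports Defs "HOL-Complex_Analysis.Complex_Analysis"
begin

text \<open>
  The theorem combines two facts. First, on a compact set the uniform closure \<open>D\<close> of the Dirichlet
  polynomials contains the coordinate function (\<open>identity_in_dirichlet_closure\<close>). As products of Dirichlet
  polynomials are Dirichlet polynomials, \<open>D\<close> is a uniformly closed algebra, so it contains all
  polynomials. Second, by Mergelyan's theorem (\<open>mergelyan\<close>), if the complement of \<open>K\<close> is connected,
  a uniformly closed algebra on \<open>K\<close> containing the coordinate function contains every function that is
  continuous on \<open>K\<close> and holomorphic in its interior.

  For the first fact, \<open>s\<close> is approximated by combinations of \<open>n\<^sup>-\<^sup>s = exp (-s ln n)\<close> with \<open>n \<le> N\<close>. Removing one
  frequency after the other by solving a linear differential equation leaves an error of at most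
  \<open>(\<Prod>n=2..N. ln n) \<bar>s\<bar>\<^sup>N / N! * N powr \<bar>s\<bar>\<close>, which tends to \<open>0\<close> because the logarithms grow so slowly.

  For Mergelyan's theorem, extend \<open>f\<close> to a continuous function with compact support and cut a
  large square into small squares \<open>S\<close> of side \<open>\<delta>\<close>. Let \<open>k\<close> be the kernel \<open>1 / u\<close> made bounded by
  \<open>1 / \<delta>\<close> for \<open>\<bar>u\<bar> < \<delta>\<close>. The pieces \<open>W\<^sub>S z = (1 / 2 \<pi> i) \<integral>\<^bsub>\<partial>S\<^esub> (f w - f z) k (w - z) dw\<close> add up to \<open>-f z\<close>,
  since inner edges cancel and \<open>f\<close> vanishes on the outer boundary (\<open>sum_cauchy_pieces\<close>). Each piece is
  bounded by the oscillation \<open>\<omega>\<close> of \<open>f\<close> at scale \<open>\<delta>\<close>, and away from \<open>S\<close> it is a genuine Cauchy integral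
  of \<open>f\<close>, which vanishes if \<open>S\<close> lies in the interior of \<open>K\<close>. Every other square has a point \<open>p\<close> of the complement
  nearby, and there the kernel \<open>1 / (z - w)\<close> is replaced by a function in the
  algebra that is bounded by a multiple of \<open>1 / \<delta>\<close> on all of \<open>K\<close> and agrees with the kernel up to \<open>\<delta>\<^sup>2 / \<bar>z - p\<bar>\<^sup>3\<close>
  (\<open>exists_bounded_cauchy_kernel\<close>). The errors have size \<open>\<omega>\<close> near the squares and decay cubically, so
  their sum over the grid is a bounded multiple of \<open>\<omega>\<close> (\<open>lattice_sum_bounded\<close>).

  The replacement kernel is elementary. The complement of \<open>K\<close> is connected and unbounded, so it
  contains an arc from \<open>p\<close> to a point \<open>b\<close> at distance \<open>\<delta>\<close>, and \<open>sqrt ((z - p) (z - b))\<close> has a branch off this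
  arc. Then \<open>(z - c) - sqrt ((z - p) (z - b))\<close>, where \<open>c\<close> is the midpoint, is bounded and behaves like
  a multiple of \<open>1 / (z - c)\<close> at infinity. It belongs to the algebra because the branch is obtained from
  square roots of functions close to \<open>1\<close>.
\<close>

section \<open>Uniformly closed algebras of functions\<close>

text \<open>Both notions of approximation that matter here, by polynomials and by Dirichlet polynomials,
  are covered by one abstraction: a set of functions that is an algebra, contains the coordinate
  function and is closed under uniform limits on \<open>K\<close>. Elements are total functions, but by
  closedness membership depends only on the values on \<open>K\<close>.\<close>

locale uniformly_closed_algebra =
  fixes K :: "complex set" and A :: "(complex \<Rightarrow> complex) set"
  assumes compact_K: "compact K"
    and const: "(\<lambda>_. c) \<in> A"
    and ident: "(\<lambda>z. z) \<in> A"
    and add: "f \<in> A \<Longrightarrow> g \<in> A \<Longrightarrow> (\<lambda>z. f z + g z) \<in> A"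
    and mult: "f \<in> A \<Longrightarrow> g \<in> A \<Longrightarrow> (\<lambda>z. f z * g z) \<in> A"
    and uniformly_closed:
      "(\<And>e. e > 0 \<Longrightarrow> \<exists>g\<in>A. \<forall>z\<in>K. norm (f z - g z) < e) \<Longrightarrow> f \<in> A"
begin

lemma cong_on: "f \<in> A \<Longrightarrow> (\<And>z. z \<in> K \<Longrightarrow> f z = g z) \<Longrightarrow> g \<in> A"
  by (rule uniformly_closed) (auto intro!: bexI[of _ f])

lemma power: "f \<in> A \<Longrightarrow> (\<lambda>z. f z ^ n) \<in> A"
  by (induction n) (auto intro: const mult)

lemma sum: "(\<And>i. i \<in> I \<Longrightarrow> f i \<in> A) \<Longrightarrow> (\<lambda>z. \<Sum>i\<in>I. f i z) \<in> A"
  by (induction I rule: infinite_finite_induct) (auto intro: const add)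

lemma diff: "f \<in> A \<Longrightarrow> g \<in> A \<Longrightarrow> (\<lambda>z. f z - g z) \<in> A"
  using add[OF _ mult[OF const[of "-1"]], of f g] by simp

text \<open>The Taylor series of \<open>\<phi>\<close> converges uniformly on the disc of radius \<open>q\<close>, which contains the
  range of \<open>u\<close>, so its partial sums in \<open>u\<close> converge uniformly on \<open>K\<close>.\<close>

lemma comp_holomorphic:
  assumes "u \<in> A" and hol: "\<phi> holomorphic_on ball 0 1" and "q < 1"
    and q: "\<And>z. z \<in> K \<Longrightarrow> norm (u z) \<le> q"
  shows "(\<lambda>z. \<phi> (u z)) \<in> A"
proof -
  define c where "c = (\<lambda>n. (deriv ^^ n) \<phi> 0 / fact n)"
  have sums: "(\<lambda>n. c n * w ^ n) sums \<phi> w" if "norm w < 1" for w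
    using holomorphic_power_series[OF hol, of w] that by (simp add: c_def)
  \<comment> \<open>If \<open>K\<close> is empty, \<open>q\<close> may be negative.\<close>
  define q' where "q' = max q 0"
  obtain q'' where q'': "q' < q''" "q'' < 1"
    using dense[of q' 1] \<open>q < 1\<close> unfolding q'_def by auto
  have "summable (\<lambda>n. c n * of_real q'' ^ n)"
    using sums[of "of_real q''"] q'' by (auto simp: sums_iff q'_def)
  then have summ: "summable (\<lambda>n. norm (c n * of_real q' ^ n))"
    by (rule powser_insidea) (use q'' in \<open>auto simp: q'_def\<close>)
  have "uniform_limit K (\<lambda>n z. \<Sum>i<n. c i * u z ^ i) (\<lambda>z. suminf (\<lambda>i. c i * u z ^ i)) sequentially"
  proof (rule Weierstrass_m_test[OF _ summ])
    fix n z assume "z \<in> K"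
    then have "norm (u z) \<le> q'" using q[of z] by (simp add: q'_def)
    then have "norm (u z) ^ n \<le> q' ^ n" by (intro power_mono) auto
    then show "norm (c n * u z ^ n) \<le> norm (c n * of_real q' ^ n)"
      using q'_def by (simp add: norm_mult norm_power mult_left_mono)
  qed
  show ?thesis
  proof (rule uniformly_closed)
    fix e :: real assume "e > 0"
    obtain n where n: "\<forall>z\<in>K. dist (\<Sum>i<n. c i * u z ^ i) (suminf (\<lambda>i. c i * u z ^ i)) < e"
      using uniform_limitD[OF \<open>uniform_limit K _ _ _\<close> \<open>e > 0\<close>] 
      by (auto simp: eventually_sequentially)
    have "suminf (\<lambda>i. c i * u z ^ i) = \<phi> (u z)" if "z \<in> K" for z
      using sums[of "u z"] q[OF that] \<open>q < 1\<close> by (auto simp: sums_iff)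
    with n show "\<exists>g\<in>A. \<forall>z\<in>K. norm (\<phi> (u z) - g z) < e"
      by (intro bexI[of _ "\<lambda>z. \<Sum>i<n. c i * u z ^ i"] sum mult const power \<open>u \<in> A\<close>)
        (auto simp: dist_norm norm_minus_commute)
  qed
qed

text \<open>The function \<open>(b - a) / (z - a)\<close> has modulus at most \<open>1/2\<close> on \<open>K\<close>. This is used with
  \<open>\<phi> u = 1 / (1 - u)\<close>, which moves the pole \<open>a\<close> to \<open>b\<close>, and with \<open>\<phi> u = csqrt (1 - u)\<close>.\<close>

lemma simple_pole_step:
  assumes "(\<lambda>z. 1 / (z - a)) \<in> A" "d > 0" "ball a d \<inter> K = {}" "norm (b - a) \<le> d / 2"
    and hol: "\<phi> holomorphic_on ball 0 1"
  shows "(\<lambda>z. \<phi> ((b - a) / (z - a))) \<in> A"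
proof -
  have "(\<lambda>z. (b - a) * (1 / (z - a))) \<in> A" by (intro mult const assms)
  then have "(\<lambda>z. \<phi> ((b - a) * (1 / (z - a)))) \<in> A"
  proof (rule comp_holomorphic[OF _ hol, of _ "1/2"])
    fix z assume "z \<in> K"
    then have "z \<notin> ball a d" using assms by auto
    then have "norm (z - a) \<ge> d" by (simp add: dist_norm norm_minus_commute)
    moreover from this have "norm (z - a) > 0" using \<open>d > 0\<close> by linarith
    ultimately show "norm ((b - a) * (1 / (z - a))) \<le> 1 / 2"
      using assms(4) by (simp add: norm_mult norm_divide divide_le_eq)
  qed simp
  then show ?thesis by simp
qed

lemma simple_pole_near:
  assumes "(\<lambda>z. 1 / (z - a)) \<in> A" "d > 0" "ball a d \<inter> K = {}" "norm (b - a) \<le> d / 2"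
  shows "(\<lambda>z. 1 / (z - b)) \<in> A"
proof -
  have "(\<lambda>u. 1 / (1 - u)) holomorphic_on ball (0::complex) 1"
    by (intro holomorphic_intros) auto
  from mult[OF assms(1) simple_pole_step[OF assms this]]
  show ?thesis
  proof (rule cong_on)
    fix z assume "z \<in> K"
    then have "z \<notin> ball a d" using assms by blast
    then have "norm (z - a) \<ge> d" by (simp add: dist_norm norm_minus_commute)
    with assms have "z \<noteq> a" "z \<noteq> b" by auto
    then show "1 / (z - a) * (1 / (1 - (b - a) / (z - a))) = 1 / (z - b)"
      using \<open>z \<noteq> a\<close> by (simp add: divide_simps)
  qed
qed

text \<open>Pole pushing: near infinity \<open>1 / (z - w)\<close> is a power series in \<open>z\<close>; from there the pole is
  moved in small steps through the connected complement of \<open>K\<close>.\<close>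

lemma simple_pole:
  assumes "connected (- K)" "w \<notin> K"
  shows "(\<lambda>z. 1 / (z - w)) \<in> A"
proof -
  obtain B where B: "B > 0" "\<And>z. z \<in> K \<Longrightarrow> norm z \<le> B"
    using compact_imp_bounded[OF compact_K] by (auto simp: bounded_pos)
  define w0 :: complex where "w0 = of_real (2 * B)"
  have w0: "w0 \<notin> K" "norm w0 = 2 * B" "w0 \<noteq> 0"
    using B by (auto simp: w0_def norm_mult abs_mult) (use B(2)[of w0] in \<open>auto simp: w0_def norm_mult\<close>)
  have *: "(\<lambda>u. - 1 / w0 * (1 / (1 - u))) holomorphic_on ball (0::complex) 1"
    by (intro holomorphic_intros) (use w0 in auto)
  have "(\<lambda>z. - 1 / w0 * (1 / (1 - (1 / w0) * z))) \<in> A"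
    by (rule comp_holomorphic[OF _ *, of _ "1/2"], intro mult const ident)
       (use w0 B in \<open>auto simp: norm_divide norm_mult divide_simps\<close>)
  then have base: "(\<lambda>z. 1 / (z - w0)) \<in> A"
  proof (rule cong_on)
    fix z assume "z \<in> K"
    then have "z \<noteq> w0" using w0 by auto
    then show "- 1 / w0 * (1 / (1 - 1 / w0 * z)) = 1 / (z - w0)"
      using w0(3) by (simp add: divide_simps)
  qed
  have "(\<lambda>z. 1 / (z - w0)) \<in> A \<longleftrightarrow> (\<lambda>z. 1 / (z - w)) \<in> A"
  proof (rule connected_equivalence_relation[OF assms(1), of w0 w
        "\<lambda>a b. (\<lambda>z. 1 / (z - a)) \<in> A \<longleftrightarrow> (\<lambda>z. 1 / (z - b)) \<in> A"])
    fix a assume "a \<in> - K"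
    moreover have "open (- K)" using compact_K by (simp add: compact_imp_closed open_Compl)
    ultimately obtain d where d: "d > 0" "ball a d \<subseteq> - K" by (meson openE)
    show "\<exists>T. openin (top_of_set (- K)) T \<and> a \<in> T \<and>
        (\<forall>b\<in>T. (\<lambda>z. 1 / (z - a)) \<in> A \<longleftrightarrow> (\<lambda>z. 1 / (z - b)) \<in> A)"
    proof (intro exI conjI ballI)
      show "openin (top_of_set (- K)) (ball a (d / 3))"
        using d subset_ball[of "d / 3" d a] by (intro open_subset) auto
      fix b assume b: "b \<in> ball a (d / 3)"
      have sub: "ball b (2 * d / 3) \<subseteq> ball a d"
        using b by (auto simp: ball_subset_ball_iff dist_commute)
      show "(\<lambda>z. 1 / (z - a)) \<in> A \<longleftrightarrow> (\<lambda>z. 1 / (z - b)) \<in> A"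
      proof
        assume "(\<lambda>z. 1 / (z - a)) \<in> A"
        then show "(\<lambda>z. 1 / (z - b)) \<in> A"
          by (rule simple_pole_near[of _ d]) (use d b in \<open>auto simp: dist_norm norm_minus_commute\<close>)
      next
        assume "(\<lambda>z. 1 / (z - b)) \<in> A"
        then show "(\<lambda>z. 1 / (z - a)) \<in> A"
          by (rule simple_pole_near[of _ "2 * d / 3"])
            (use d b sub in \<open>auto simp: dist_norm norm_minus_commute\<close>)
      qed
    qed (use d in auto)
  qed (use assms w0 in auto)
  with base show ?thesis by simp
qed

end

section \<open>Square roots of quotients\<close>

lemma tendsto_const_div_at_infinity: "((\<lambda>z. c / (z - a)) \<longlongrightarrow> (0::complex)) at_infinity"
  using tendsto_add_filterlim_at_infinity'[OF filterlim_ident tendsto_const[of "-a"]]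
  by (intro tendsto_divide_0[OF tendsto_const]) simp

context uniformly_closed_algebra
begin

text \<open>Here \<open>h\<close> is a branch of \<open>sqrt ((z - b) / (z - a))\<close> that tends to \<open>1\<close> at infinity. It is used for
  points \<open>a\<close>, \<open>b\<close> that are joined by a curve in \<open>cball p r - K\<close>. Such a branch exists off the curve; only its values on \<open>K\<close> and on the exterior of a disc around the curve are
  recorded. The exterior is needed because \<open>K\<close> may be disconnected: continuity out there is what
  fixes the sign at each point of \<open>K\<close> far from \<open>p\<close>.\<close>

definition sqrt_quotient ::
  "complex \<Rightarrow> real \<Rightarrow> complex \<Rightarrow> complex \<Rightarrow> (complex \<Rightarrow> complex) \<Rightarrow> bool" where
  "sqrt_quotient p r a b h \<longleftrightarrow> h \<in> A \<and>
     (\<forall>z \<in> K \<union> {z. norm (z - p) > 2 * r}. (h z)\<^sup>2 = (z - b) / (z - a)) \<and>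
     continuous_on {z. norm (z - p) > 2 * r} h \<and> (h \<longlongrightarrow> 1) at_infinity"

text \<open>When \<open>b\<close> is much closer to \<open>a\<close> than \<open>K\<close> is, \<open>(z - b) / (z - a) = 1 - (b - a) / (z - a)\<close> lies in
  the right half-plane for \<open>z\<close> in \<open>K\<close> or outside the disc, and there the principal square root is
  holomorphic.\<close>

lemma sqrt_quotient_near:
  assumes "connected (- K)" "a \<in> cball p r" "0 < d" "d \<le> r" "ball a d \<inter> K = {}"
    and "norm (b - a) \<le> d / 2"
  shows "sqrt_quotient p r a b (\<lambda>z. csqrt (1 - (b - a) / (z - a)))"
  unfolding sqrt_quotient_def
proof (intro conjI ballI)
  have "a \<notin> K" using assms(3,5) centre_in_ball[of a d] by blast
  have "(\<lambda>u. csqrt (1 - u)) holomorphic_on ball 0 1"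
  proof (intro holomorphic_intros)
    fix u :: complex assume "u \<in> ball 0 1"
    then have "Re u < 1" using complex_Re_le_cmod[of u] by simp
    then show "1 - u \<notin> \<real>\<^sub>\<le>\<^sub>0" by (auto simp: complex_nonpos_Reals_iff)
  qed
  from simple_pole_step[OF simple_pole[OF assms(1) \<open>a \<notin> K\<close>] assms(3,5,6) this]
  show "(\<lambda>z. csqrt (1 - (b - a) / (z - a))) \<in> A" .
  have far: "norm (z - a) > r" if "norm (z - p) > 2 * r" for z
    using that norm_triangle_ineq[of "z - a" "a - p"] assms(2) 
    by (simp add: dist_norm norm_minus_commute)
  show "(csqrt (1 - (b - a) / (z - a)))\<^sup>2 = (z - b) / (z - a)"
    if "z \<in> K \<union> {z. norm (z - p) > 2 * r}" for z
  proof -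
    have "z \<noteq> a" using that \<open>a \<notin> K\<close> far[of z] assms by auto
    then show ?thesis by (simp add: divide_simps)
  qed
  show "continuous_on {z. norm (z - p) > 2 * r} (\<lambda>z. csqrt (1 - (b - a) / (z - a)))"
  proof (rule continuous_on_compose2[of "- \<real>\<^sub>\<le>\<^sub>0" csqrt])
    show "continuous_on (- \<real>\<^sub>\<le>\<^sub>0) csqrt"
      by (intro continuous_at_imp_continuous_on ballI continuous_at_csqrt) auto
    show "continuous_on {z. norm (z - p) > 2 * r} (\<lambda>z. 1 - (b - a) / (z - a))"
      using far assms by (intro continuous_intros) fastforce
    have "1 - (b - a) / (z - a) \<in> - \<real>\<^sub>\<le>\<^sub>0" if "norm (z - p) > 2 * r" for z
    proof -
      have *: "norm (z - a) > r" using that far by simp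
      have "norm ((b - a) / (z - a)) < 1" 
        using * assms by (simp add: norm_divide divide_less_eq)
      then have "Re ((b - a) / (z - a)) < 1" using complex_Re_le_cmod le_less_trans by blast
      then show ?thesis by (auto simp: complex_nonpos_Reals_iff)
    qed
    then show "(\<lambda>z. 1 - (b - a) / (z - a)) ` {z. norm (z - p) > 2 * r} \<subseteq> - \<real>\<^sub>\<le>\<^sub>0" by auto
  qed
  have "((\<lambda>z. 1 - (b - a) / (z - a)) \<longlongrightarrow> 1 - 0) at_infinity"
    by (intro tendsto_intros tendsto_const_div_at_infinity)
  then have "((\<lambda>z. csqrt (1 - (b - a) / (z - a))) \<longlongrightarrow> csqrt 1) at_infinity"
    by (intro isCont_tendsto_compose[OF continuous_at_csqrt]) auto
  then show "((\<lambda>z. csqrt (1 - (b - a) / (z - a))) \<longlongrightarrow> 1) at_infinity" by simp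
qed

lemma sqrt_quotient_trans:
  assumes "sqrt_quotient p r a b g" "sqrt_quotient p r b c h" "b \<in> cball p r - K" "r > 0"
  shows "sqrt_quotient p r a c (\<lambda>z. g z * h z)"
  using assms unfolding sqrt_quotient_def
proof (intro conjI ballI; (elim conjE)?)
  fix z assume z: "z \<in> K \<union> {z. norm (z - p) > 2 * r}"
    and "\<forall>z\<in>K \<union> {z. norm (z - p) > 2 * r}. (g z)\<^sup>2 = (z - b) / (z - a)"
    and "\<forall>z\<in>K \<union> {z. norm (z - p) > 2 * r}. (h z)\<^sup>2 = (z - c) / (z - b)"
  moreover have "z \<noteq> b" using z assms by (auto simp: dist_norm norm_minus_commute)
  ultimately show "(g z * h z)\<^sup>2 = (z - c) / (z - a)"
    by (simp add: power_mult_distrib)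
qed (auto intro: mult continuous_intros tendsto_eq_intros)

lemma sqrt_quotient_sym:
  assumes "connected (- K)" "sqrt_quotient p r a b h" "a \<in> cball p r - K" "b \<in> cball p r - K" "r > 0"
  shows "sqrt_quotient p r b a (\<lambda>z. h z * ((z - a) * (1 / (z - b))))"
  unfolding sqrt_quotient_def
proof (intro conjI ballI)
  note h = assms(2)[unfolded sqrt_quotient_def]
  show "(\<lambda>z. h z * ((z - a) * (1 / (z - b)))) \<in> A"
    using h assms by (intro mult diff ident const simple_pole) auto
  show "(h z * ((z - a) * (1 / (z - b))))\<^sup>2 = (z - a) / (z - b)"
    if z: "z \<in> K \<union> {z. norm (z - p) > 2 * r}" for z
  proof -
    have "z \<noteq> a" "z \<noteq> b" using z assms by (auto simp: dist_norm norm_minus_commute)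
    moreover have "(h z)\<^sup>2 = (z - b) / (z - a)" using h z by blast
    ultimately show ?thesis
      by (simp add: power_mult_distrib power_divide) (simp add: power2_eq_square)
  qed
  show "continuous_on {z. norm (z - p) > 2 * r} (\<lambda>z. h z * ((z - a) * (1 / (z - b))))"
    using h assms by (intro continuous_intros) (auto simp: dist_norm norm_minus_commute)
  have "((\<lambda>z. 1 + (b - a) / (z - b)) \<longlongrightarrow> 1 + 0) at_infinity"
    by (intro tendsto_intros tendsto_const_div_at_infinity)
  then have "((\<lambda>z. (z - a) * (1 / (z - b))) \<longlongrightarrow> 1 + 0) at_infinity"
  proof (rule Lim_transform_eventually)
    show "\<forall>\<^sub>F z in at_infinity. 1 + (b - a) / (z - b) = (z - a) * (1 / (z - b))"
      using eventually_not_equal_at_infinity[of b] by eventually_elim (simp add: divide_simps)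
  qed
  then have *: "((\<lambda>z. (z - a) * (1 / (z - b))) \<longlongrightarrow> 1) at_infinity" by simp
  have "(h \<longlongrightarrow> 1) at_infinity" using h by simp
  from tendsto_mult[OF this *]
  show "((\<lambda>z. h z * ((z - a) * (1 / (z - b)))) \<longlongrightarrow> 1) at_infinity" by simp
qed

text \<open>The relation ``there is a branch for \<open>a\<close> and \<open>b\<close>'' is an equivalence relation with open
  classes, hence it is total on any connected subset of \<open>cball p r - K\<close>. Such a set is the initial
  piece, up to its exit from the disc, of a path in \<open>-K\<close> from \<open>p\<close> to a distant point.\<close>

lemma exists_sqrt_quotient:
  assumes conn: "connected (- K)" and "p \<notin> K" "r > 0"
  obtains b h where "norm (b - p) = r" "sqrt_quotient p r p b h"
proof -
  have op: "open (- K)" using compact_K by (simp add: compact_imp_closed open_Compl)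
  obtain B where B: "\<And>z. z \<in> K \<Longrightarrow> norm z \<le> B"
    using compact_imp_bounded[OF compact_K] by (auto simp: bounded_iff)
  define q :: complex where "q = of_real (max 0 B + norm p + r + 1)"
  have nq: "norm q = max 0 B + norm p + r + 1" using assms unfolding q_def norm_of_real by simp
  have "q \<notin> K" using B[of q] nq assms norm_ge_zero[of p] by (auto simp del: norm_ge_zero)
  have "q \<notin> cball p r"
    using norm_triangle_ineq[of "q - p" p] nq by (simp add: dist_norm norm_minus_commute)
  obtain g where g: "path g" "path_image g \<subseteq> - K" "pathstart g = p" "pathfinish g = q"
    using connected_open_path_connected[OF op conn] \<open>p \<notin> K\<close> \<open>q \<notin> K\<close>
    unfolding path_connected_def by (meson ComplI)
  obtain \<gamma> where \<gamma>: "path \<gamma>" "pathstart \<gamma> = p" "path_image \<gamma> \<subseteq> path_image g \<inter> cball p r"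
      "pathfinish \<gamma> \<in> frontier (cball p r)"
    using exists_path_subpath_to_frontier_closed[OF closed_cball g(1), of p r] g(3,4) 
      \<open>q \<notin> cball p r\<close> \<open>r > 0\<close> by auto
  define S where "S = path_image \<gamma>"
  have S: "S \<subseteq> cball p r - K" using \<gamma> g(2) by (auto simp: S_def)
  define b where "b = pathfinish \<gamma>"
  have "norm (b - p) = r"
    using \<gamma>(4) \<open>r > 0\<close> by (simp add: b_def frontier_cball dist_norm norm_minus_commute)
  moreover have "\<exists>h. sqrt_quotient p r p b h"
  proof (rule connected_equivalence_relation[of S p b "\<lambda>a b. \<exists>h. sqrt_quotient p r a b h"])
    show "connected S" "p \<in> S" "b \<in> S"
      using \<gamma> by (auto simp: S_def b_def connected_path_image)
    show "\<exists>h. sqrt_quotient p r y x h" if "\<exists>h. sqrt_quotient p r x y h" "x \<in> S" "y \<in> S" for x y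
      using that S sqrt_quotient_sym[OF conn _ _ _ \<open>r > 0\<close>, of p x y] by blast
    show "\<exists>h. sqrt_quotient p r x z h" if "\<exists>h. sqrt_quotient p r x y h"
      "\<exists>h. sqrt_quotient p r y z h" "x \<in> S" "y \<in> S" "z \<in> S" for x y z
      using that S sqrt_quotient_trans[OF _ _ _ \<open>r > 0\<close>, of p x y _ z] by blast
    fix a assume "a \<in> S"
    then have "a \<in> - K" using S by auto
    then obtain d0 where d0: "d0 > 0" "ball a d0 \<subseteq> - K" using op by (meson openE)
    define d where "d = min d0 r"
    have d: "0 < d" "d \<le> r" "ball a d \<inter> K = {}"
      using d0 \<open>r > 0\<close> subset_ball[of d d0 a] by (auto simp: d_def)
    show "\<exists>T. openin (top_of_set S) T \<and> a \<in> T \<and> (\<forall>x\<in>T. \<exists>h. sqrt_quotient p r a x h)"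
    proof (intro exI conjI ballI)
      show "openin (top_of_set S) (S \<inter> ball a (d / 2))" by (simp add: openin_open_Int)
      show "a \<in> S \<inter> ball a (d / 2)" using \<open>a \<in> S\<close> d by auto
      fix x assume "x \<in> S \<inter> ball a (d / 2)"
      then show "sqrt_quotient p r a x (\<lambda>z. csqrt (1 - (x - a) / (z - a)))"
        using \<open>a \<in> S\<close> S d
        by (intro sqrt_quotient_near[OF conn _ d]) (auto simp: dist_norm norm_minus_commute)
    qed
  qed
  ultimately show ?thesis using that by blast
qed

end

section \<open>A bounded substitute for the Cauchy kernel\<close>

text \<open>The equation \<open>S\<^sup>2 = u\<^sup>2 - d\<^sup>2\<close> factors as \<open>(u - S) (u + S) = d\<^sup>2\<close>, so that \<open>g = 2 / (u + S)\<close>. Up to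
  the factor \<open>2 / d\<close>, this is the branch of the inverse Joukowski map that vanishes at infinity; it behaves like \<open>1 / u\<close> at infinity, and the
  error is of third order because the expansion of \<open>g\<close> contains only odd powers of \<open>1 / u\<close>.\<close>

lemma inverse_joukowski_bounds:
  fixes u S d g :: complex
  assumes S: "S\<^sup>2 = u\<^sup>2 - d\<^sup>2" and le: "norm u \<le> norm (u + S)" and "u \<noteq> 0" "d \<noteq> 0"
    and g: "g = 2 / d\<^sup>2 * (u - S)"
  shows "norm g \<le> 2 / norm u" "norm (g - 1 / u) \<le> (norm d)\<^sup>2 / norm u ^ 3"
proof -
  have nz: "u + S \<noteq> 0" using le \<open>u \<noteq> 0\<close> by auto
  have prod: "(u - S) * (u + S) = d\<^sup>2" using S by (simp add: algebra_simps power2_eq_square)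
  then have "u - S = d\<^sup>2 / (u + S)" using nz by (simp add: eq_divide_eq)
  then have g': "g = 2 / (u + S)" using \<open>d \<noteq> 0\<close> unfolding g by simp
  show "norm g \<le> 2 / norm u" unfolding g' norm_divide 
    using le \<open>u \<noteq> 0\<close> by (simp add: frac_le)
  have "g - 1 / u = (u - S) / (u * (u + S))"
    using nz \<open>u \<noteq> 0\<close> unfolding g' by (simp add: divide_simps algebra_simps)
  also have "\<dots> = d\<^sup>2 / (u * (u + S)\<^sup>2)"
    using nz \<open>u \<noteq> 0\<close> prod by (simp add: divide_simps power2_eq_square)
  also have "norm \<dots> = (norm d)\<^sup>2 / (norm u * norm (u + S) ^ 2)"
    by (simp add: norm_divide norm_mult norm_power)
  also have "\<dots> \<le> (norm d)\<^sup>2 / norm u ^ 3"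
    unfolding power3_eq_cube power2_eq_square[of "norm (u + S)"] mult.assoc
    using le \<open>u \<noteq> 0\<close> by (intro divide_left_mono mult_left_mono mult_mono mult_pos_pos) auto
  finally show "norm (g - 1 / u) \<le> (norm d)\<^sup>2 / norm u ^ 3" .
qed

text \<open>The geometric expansion of \<open>1 / (z - w)\<close> in \<open>1 / (z - c)\<close>, cut after two terms, with \<open>1 / (z - c)\<close>
  replaced by \<open>g\<close>. Both changes cost only \<open>r\<^sup>2 / \<bar>z - p\<bar>\<^sup>3\<close>, a decay whose sum over a
  plane lattice converges.\<close>

lemma cauchy_kernel_two_terms:
  fixes z w p c d g :: complex
  assumes r: "r > 0" "norm (c - p) = r / 2" "norm d = r / 2" "norm (w - p) \<le> 2 * r" "norm (z - p) > 4 * r"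
    and g: "norm g \<le> 2 / norm (z - c)" "norm (g - 1 / (z - c)) \<le> (norm d)\<^sup>2 / norm (z - c) ^ 3"
  shows "norm (1 / (z - w) - (g + (w - c) * g\<^sup>2)) \<le> 60 * r\<^sup>2 / norm (z - p) ^ 3"
proof -
  define t where "t = norm (z - p)"
  define u where "u = z - c"
  define v where "v = w - c"
  have t: "t > 4 * r" "t > 0" using r by (auto simp: t_def)
  have u: "norm u \<ge> t / 2" "norm u \<ge> 2 * r"
    using norm_triangle_ineq[of "z - c" "c - p"] r by (auto simp: u_def t_def)
  have zw: "norm (z - w) \<ge> t / 2"
    using norm_triangle_ineq[of "z - w" "w - p"] r by (auto simp: t_def)
  have v: "norm v \<le> 5 / 2 * r"
    using norm_triangle_ineq[of "w - p" "p - c"] r by (auto simp: v_def norm_minus_commute)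
  have nz: "u \<noteq> 0" "z - w \<noteq> 0" using u zw t by auto
  have "1 / (z - w) - (1 / u + v / u\<^sup>2) = v\<^sup>2 / (u\<^sup>2 * (z - w))"
  proof -
    have "u = (z - w) + v" by (simp add: u_def v_def)
    then show ?thesis using nz by (simp add: divide_simps) (simp add: algebra_simps power2_eq_square)
  qed
  also have "norm \<dots> = (norm v)\<^sup>2 / ((norm u)\<^sup>2 * norm (z - w))"
    by (simp add: norm_divide norm_mult norm_power)
  also have "\<dots> \<le> (5 / 2 * r)\<^sup>2 / ((t / 2)\<^sup>2 * (t / 2))"
    using u v zw t r by (intro frac_le mult_mono power_mono mult_pos_pos) auto
  also have "\<dots> = 50 * (r\<^sup>2 / t ^ 3)" using t by (simp add: field_simps power2_eq_square power3_eq_cube)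
  finally have e1: "norm (1 / (z - w) - (1 / u + v / u\<^sup>2)) \<le> 50 * (r\<^sup>2 / t ^ 3)" .
  have "norm (g - 1 / u) \<le> (norm d)\<^sup>2 / norm u ^ 3" using g by (simp add: u_def)
  also have "\<dots> \<le> (r / 2)\<^sup>2 / (t / 2) ^ 3"
    using u t r by (intro frac_le power_mono) auto
  also have "\<dots> = 2 * (r\<^sup>2 / t ^ 3)" using t by (simp add: field_simps power2_eq_square power3_eq_cube)
  finally have e2: "norm (g - 1 / u) \<le> 2 * (r\<^sup>2 / t ^ 3)" .
  have "norm (g + 1 / u) \<le> 3 / norm u"
    using norm_triangle_ineq[of g "1 / u"] g by (simp add: u_def norm_divide)
  also have "\<dots> \<le> 3 / (2 * r)" using u r nz by (intro divide_left_mono mult_pos_pos) auto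
  finally have e3: "norm (g + 1 / u) \<le> 3 / (2 * r)" .
  have "norm (v * ((g + 1 / u) * (g - 1 / u))) \<le> (5 / 2 * r) * ((3 / (2 * r)) * (2 * (r\<^sup>2 / t ^ 3)))"
    unfolding norm_mult using v e2 e3 r by (intro mult_mono) auto
  also have "\<dots> \<le> 8 * (r\<^sup>2 / t ^ 3)" using r t by (simp add: field_simps)
  finally have e4: "norm (v * ((g + 1 / u) * (g - 1 / u))) \<le> 8 * (r\<^sup>2 / t ^ 3)" .
  have "1 / (z - w) - (g + v * g\<^sup>2) =
      (1 / (z - w) - (1 / u + v / u\<^sup>2)) - (g - 1 / u) - v * ((g + 1 / u) * (g - 1 / u))"
    by (simp add: algebra_simps power2_eq_square)
  also have "norm \<dots> \<le> 50 * (r\<^sup>2 / t ^ 3) + 2 * (r\<^sup>2 / t ^ 3) + 8 * (r\<^sup>2 / t ^ 3)"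
    by (intro order_trans[OF norm_triangle_ineq4] add_mono e1 e2 e4)
  also have "\<dots> = 60 * r\<^sup>2 / t ^ 3" by simp
  finally show ?thesis unfolding t_def v_def .
qed

context uniformly_closed_algebra
begin

text \<open>Write \<open>u = z - c\<close> with \<open>c\<close> the midpoint of \<open>p\<close> and \<open>b\<close>, \<open>d = (b - p) / 2\<close> and \<open>S = (z - p) h\<close>. Outside
  the disc of radius \<open>2 r\<close> the moduli of \<open>u + S\<close> and \<open>u - S\<close> never agree: their product is \<open>\<bar>d\<bar>\<^sup>2\<close>, so
  both would be \<open>\<bar>d\<bar>\<close>, but their sum is at least \<open>2 \<bar>u\<bar>\<close> and \<open>\<bar>u\<bar> > \<bar>d\<bar>\<close> there. The exterior is connected and \<open>S\<close> is close to \<open>u\<close> at infinity, so \<open>u + S\<close> is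
  everywhere the larger one.\<close>

lemma sqrt_quotient_dominates:
  assumes h: "sqrt_quotient p r p b h" and r: "r > 0" "norm (b - p) = r"
    and z: "norm (z - p) > 2 * r"
  shows "norm (z - (p + b) / 2) \<le> norm (z - (p + b) / 2 + (z - p) * h z)"
proof -
  define d where "d = (b - p) / 2"
  define c where "c = (p + b) / 2"
  define u where "u = (\<lambda>z. z - c)"
  define S where "S = (\<lambda>z. (z - p) * h z)"
  define far where "far = {z. norm (z - p) > 2 * r}"
  have nd: "norm d = r / 2" using r by (simp add: d_def norm_divide)
  have cp: "c = p + d" "b = c + d" by (auto simp: c_def d_def field_simps)
  have u_gt: "norm (u z) > norm d" if "z \<in> far" for z
    using that norm_triangle_ineq[of "u z" d] nd r by (simp add: far_def u_def cp)
  have SS: "(S z)\<^sup>2 = (u z)\<^sup>2 - d\<^sup>2" if "z \<in> far" for z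
  proof -
    have "z \<noteq> p" using that r by (auto simp: far_def)
    moreover have "(h z)\<^sup>2 = (z - b) / (z - p)"
      using h that by (auto simp: sqrt_quotient_def far_def)
    ultimately have "(S z)\<^sup>2 = (z - p) * (z - b)"
      by (simp add: S_def power_mult_distrib) (simp add: power2_eq_square)
    also have "\<dots> = (u z)\<^sup>2 - d\<^sup>2" by (simp add: u_def cp algebra_simps power2_eq_square)
    finally show ?thesis .
  qed
  have ne: "norm (u z + S z) \<noteq> norm (u z - S z)" if "z \<in> far" for z
  proof
    assume eq: "norm (u z + S z) = norm (u z - S z)"
    have "(u z - S z) * (u z + S z) = d\<^sup>2" using SS[OF that] by (simp add: algebra_simps power2_eq_square)
    then have "norm (u z - S z) * norm (u z + S z) = (norm d)\<^sup>2" by (metis norm_mult norm_power)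
    then have "(norm (u z + S z))\<^sup>2 = (norm d)\<^sup>2" using eq by (simp add: power2_eq_square)
    then have "norm (u z + S z) = norm d" by (simp add: power2_eq_iff_nonneg)
    moreover have "norm (2 * u z) \<le> norm (u z + S z) + norm (u z - S z)"
      using norm_triangle_ineq[of "u z + S z" "u z - S z"] by simp
    ultimately show False using eq u_gt[OF that] by (simp add: norm_mult)
  qed
  have far: "far = - cball p (2 * r)"
    by (auto simp: far_def dist_norm norm_minus_commute)
  have conn: "connected far"
    unfolding far by (rule connected_complement_bounded_convex) auto
  define \<phi> where "\<phi> = (\<lambda>z. norm (u z + S z) - norm (u z - S z))"
  have "continuous_on far \<phi>"
    using h unfolding \<phi>_def u_def S_def far_def sqrt_quotient_def by (intro continuous_intros) auto
  then have "connected (\<phi> ` far)" by (rule connected_continuous_image[OF _ conn])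
  have "((\<lambda>z. (z - p) / (z - c)) \<longlongrightarrow> 1) at_infinity"
  proof -
    have "((\<lambda>z. 1 + (c - p) / (z - c)) \<longlongrightarrow> 1 + 0) at_infinity"
      by (intro tendsto_intros tendsto_const_div_at_infinity)
    then have "((\<lambda>z. (z - p) / (z - c)) \<longlongrightarrow> 1 + 0) at_infinity"
    proof (rule Lim_transform_eventually)
      show "\<forall>\<^sub>F z in at_infinity. 1 + (c - p) / (z - c) = (z - p) / (z - c)"
        using eventually_not_equal_at_infinity[of c] by eventually_elim (simp add: divide_simps)
    qed
    then show ?thesis by simp
  qed
  moreover have "(h \<longlongrightarrow> 1) at_infinity" using h by (simp add: sqrt_quotient_def)
  ultimately have "((\<lambda>z. (z - p) / (z - c) * h z) \<longlongrightarrow> 1 * 1) at_infinity"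
    by (rule tendsto_mult)
  then have "((\<lambda>z. (z - p) / (z - c) * h z) \<longlongrightarrow> 1) at_infinity" by simp
  then have "\<forall>\<^sub>F z in at_infinity. dist ((z - p) / (z - c) * h z) 1 < 1" 
    by (rule tendstoD) simp
  moreover have "\<forall>\<^sub>F z in at_infinity. z \<in> far"
    unfolding far eventually_at_infinity
  proof (intro exI[of _ "2 * r + norm p + 1"] allI impI)
    fix z :: complex assume "2 * r + norm p + 1 \<le> norm z"
    then show "z \<in> - cball p (2 * r)"
      using norm_triangle_sub[of z p] by (simp add: dist_norm norm_minus_commute)
  qed
  ultimately have "\<forall>\<^sub>F z in at_infinity. dist ((z - p) / (z - c) * h z) 1 < 1 \<and> z \<in> far"
    by (rule eventually_conj)
  then obtain z0 where z0: "dist ((z0 - p) / (z0 - c) * h z0) 1 < 1" "z0 \<in> far"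
    using eventually_happens'[OF trivial_limit_at_infinity] by blast
  have "u z0 \<noteq> 0" using u_gt[OF z0(2)] by auto
  then have "S z0 - u z0 = u z0 * ((z0 - p) / (z0 - c) * h z0 - 1)"
    by (simp add: u_def S_def field_simps)
  then have "norm (S z0 - u z0) < norm (u z0)"
    using z0(1) \<open>u z0 \<noteq> 0\<close> by (simp add: norm_mult dist_norm)
  moreover have "norm (2 * u z0) \<le> norm (u z0 + S z0) + norm (u z0 - S z0)"
    using norm_triangle_ineq[of "u z0 + S z0" "u z0 - S z0"] by simp
  ultimately have "\<phi> z0 > 0" by (simp add: \<phi>_def norm_minus_commute norm_mult)
  have "\<phi> z > 0"
  proof (rule ccontr)
    assume "\<not> \<phi> z > 0"
    moreover have "z \<in> far" using z by (simp add: far_def)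
    ultimately have "0 \<in> \<phi> ` far"
      using connectedD_interval[OF \<open>connected (\<phi> ` far)\<close>, of "\<phi> z" "\<phi> z0" 0] \<open>\<phi> z0 > 0\<close> z0 by auto
    then show False using ne by (auto simp: \<phi>_def)
  qed
  moreover have "norm (2 * u z) \<le> norm (u z + S z) + norm (u z - S z)"
    using norm_triangle_ineq[of "u z + S z" "u z - S z"] by simp
  moreover have "norm (2 * u z) = 2 * norm (u z)" by (simp add: norm_mult)
  ultimately have "norm (u z) \<le> norm (u z + S z)" by (simp add: \<phi>_def)
  then show ?thesis by (simp add: u_def S_def c_def)
qed

text \<open>The key to Mergelyan's theorem: a substitute for the Cauchy kernel \<open>1 / (z - w)\<close>, with \<open>w\<close> near
  \<open>p\<close>, that belongs to the algebra and stays of size \<open>1 / r\<close> on all of \<open>K\<close>, even next to the pole.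
  The classical proof takes \<open>g\<close> from the Riemann map of the complement of a continuum and
  estimates it by Koebe's theorem; for the two endpoints of an arc the explicit function
  \<open>2 (u - sqrt (u\<^sup>2 - d\<^sup>2)) / d\<^sup>2\<close> suffices.\<close>

lemma exists_bounded_cauchy_kernel:
  assumes conn: "connected (- K)" and "p \<notin> K" and r: "r > 0"
  obtains c g where "g \<in> A" "norm (c - p) \<le> r" "\<And>z. z \<in> K \<Longrightarrow> norm (g z) \<le> 44 / r"
    "\<And>z w. z \<in> K \<Longrightarrow> norm (z - p) > 4 * r \<Longrightarrow> norm (w - p) \<le> 2 * r \<Longrightarrow>
      norm (1 / (z - w) - (g z + (w - c) * (g z)\<^sup>2)) \<le> 60 * r\<^sup>2 / norm (z - p) ^ 3"
proof -
  obtain b h where b: "norm (b - p) = r" and h: "sqrt_quotient p r p b h"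
    using exists_sqrt_quotient[OF assms] by blast
  define d where "d = (b - p) / 2"
  define c where "c = (p + b) / 2"
  define S where "S = (\<lambda>z. (z - p) * h z)"
  define g where "g = (\<lambda>z. 2 / d\<^sup>2 * (z - c - S z))"
  have nd: "norm d = r / 2" using b by (simp add: d_def norm_divide)
  have cp: "c = p + d" "b = c + d" by (auto simp: c_def d_def field_simps)
  have "d \<noteq> 0" using nd r by auto
  have "g \<in> A"
    unfolding g_def S_def using h 
    by (intro mult diff const ident) (auto simp: sqrt_quotient_def)
  have SS: "(S z)\<^sup>2 = (z - c)\<^sup>2 - d\<^sup>2" if "z \<in> K" for z
  proof -
    have "z \<noteq> p" using that \<open>p \<notin> K\<close> by auto
    moreover have "(h z)\<^sup>2 = (z - b) / (z - p)"
      using h that by (auto simp: sqrt_quotient_def)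
    ultimately have "(S z)\<^sup>2 = (z - p) * (z - b)"
      by (simp add: S_def power_mult_distrib) (simp add: power2_eq_square)
    also have "\<dots> = (z - c)\<^sup>2 - d\<^sup>2" by (simp add: cp algebra_simps power2_eq_square)
    finally show ?thesis .
  qed
  have far: "norm (g z) \<le> 2 / norm (z - c)" "norm (g z - 1 / (z - c)) \<le> (norm d)\<^sup>2 / norm (z - c) ^ 3"
    "norm (z - c) \<ge> 3 / 2 * r"
    if z: "z \<in> K" "norm (z - p) > 2 * r" for z
  proof -
    show zc: "norm (z - c) \<ge> 3 / 2 * r"
      using norm_triangle_ineq[of "z - c" "c - p"] z nd by (simp add: cp)
    then have "z - c \<noteq> 0" using r by auto
    moreover have "norm (z - c) \<le> norm (z - c + S z)"
      using sqrt_quotient_dominates[OF h r b z(2)] by (simp add: c_def S_def)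
    ultimately show "norm (g z) \<le> 2 / norm (z - c)"
       "norm (g z - 1 / (z - c)) \<le> (norm d)\<^sup>2 / norm (z - c) ^ 3"
      using inverse_joukowski_bounds[OF SS[OF z(1)] _ _ \<open>d \<noteq> 0\<close> refl] by (auto simp: g_def)
  qed
  show ?thesis
  proof (rule that[OF \<open>g \<in> A\<close>])
    show "norm (c - p) \<le> r" using nd r by (simp add: cp)
    show "norm (g z) \<le> 44 / r" if z: "z \<in> K" for z
    proof (cases "norm (z - p) > 2 * r")
      case True
      have "norm (g z) \<le> 2 / norm (z - c)" using far[OF z True] by auto
      also have "\<dots> \<le> 2 / (3 / 2 * r)" using far[OF z True] r by (intro divide_left_mono mult_pos_pos) auto
      also have "\<dots> \<le> 44 / r" using r by (simp add: divide_simps)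
      finally show ?thesis .
    next
      case False
      have zc: "norm (z - c) \<le> 5 / 2 * r"
        using norm_triangle_ineq4[of "z - p" d] False nd by (simp add: cp algebra_simps)
      have "(norm (S z))\<^sup>2 = norm ((z - c)\<^sup>2 - d\<^sup>2)"
        using SS[OF z] by (metis norm_power)
      also have "\<dots> \<le> (norm (z - c))\<^sup>2 + (norm d)\<^sup>2"
        using norm_triangle_ineq4[of "(z - c)\<^sup>2" "d\<^sup>2"] by (simp add: norm_power)
      also have "\<dots> \<le> (5 / 2 * r)\<^sup>2 + (r / 2)\<^sup>2"
        using zc nd by (intro add_mono power_mono) auto
      also have "\<dots> \<le> (3 * r)\<^sup>2" by (simp add: power2_eq_square)
      finally have "norm (S z) \<le> 3 * r" by (rule power2_le_imp_le) (use r in simp)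
      then have "norm (z - c - S z) \<le> 11 / 2 * r"
        using norm_triangle_ineq4[of "z - c" "S z"] zc by simp
      then have "norm (g z) \<le> 2 / (r / 2)\<^sup>2 * (11 / 2 * r)"
        unfolding g_def norm_mult norm_divide norm_power nd by (intro mult_mono) auto
      also have "\<dots> = 44 / r" using r by (simp add: field_simps power2_eq_square)
      finally show ?thesis .
    qed
    show "norm (1 / (z - w) - (g z + (w - c) * (g z)\<^sup>2)) \<le> 60 * r\<^sup>2 / norm (z - p) ^ 3"
      if "z \<in> K" "norm (z - p) > 4 * r" "norm (w - p) \<le> 2 * r" for z w
      using that far[of z] nd r by (intro cauchy_kernel_two_terms[of r c p d]) (auto simp: cp)
  qed
qed

end

section \<open>Integrals over a grid of squares, and lattice sums\<close>

lemma contour_integral_rectpath_sides: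
  assumes "continuous_on (path_image (rectpath (Complex x y) (Complex x' y'))) f"
  shows "contour_integral (rectpath (Complex x y) (Complex x' y')) f =
    contour_integral (linepath (Complex x y) (Complex x' y)) f
    + contour_integral (linepath (Complex x' y) (Complex x' y')) f
    - contour_integral (linepath (Complex x y') (Complex x' y')) f
    - contour_integral (linepath (Complex x y) (Complex x y')) f"
proof -
  have sub: "continuous_on (closed_segment (Complex x y) (Complex x' y)) f"
    "continuous_on (closed_segment (Complex x' y) (Complex x' y')) f"
    "continuous_on (closed_segment (Complex x' y') (Complex x y')) f"
    "continuous_on (closed_segment (Complex x y') (Complex x y)) f"
    using assms by (auto intro: continuous_on_subset simp: rectpath_def Let_def path_image_join)
  then have "contour_integral (rectpath (Complex x y) (Complex x' y')) f =
    contour_integral (linepath (Complex x y) (Complex x' y)) f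
    + contour_integral (linepath (Complex x' y) (Complex x' y')) f
    + contour_integral (linepath (Complex x' y') (Complex x y')) f
    + contour_integral (linepath (Complex x y') (Complex x y)) f"
    by (simp add: rectpath_def Let_def contour_integral_join contour_integrable_continuous_linepath
        contour_integrable_joinI valid_path_join)
  then show ?thesis
    using sub contour_integral_reverse_linepath[of "Complex x' y'" "Complex x y'" f]
      contour_integral_reverse_linepath[of "Complex x y'" "Complex x y" f]
    by simp
qed

lemma contour_integrable_rectpath:
  assumes "continuous_on (path_image (rectpath a b)) f"
  shows "f contour_integrable_on rectpath a b"
proof -
  have "continuous_on (closed_segment a (Complex (Re b) (Im a))) f"
    "continuous_on (closed_segment (Complex (Re b) (Im a)) b) f"
    "continuous_on (closed_segment b (Complex (Re a) (Im b))) f"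
    "continuous_on (closed_segment (Complex (Re a) (Im b)) a) f"
    using assms by (auto intro: continuous_on_subset simp: rectpath_def Let_def path_image_join)
  then show ?thesis
    by (simp add: rectpath_def Let_def contour_integrable_continuous_linepath
        contour_integrable_joinI valid_path_join)
qed

lemma contour_integral_rectpath_bound:
  assumes cont: "continuous_on (path_image (rectpath (Complex x y) (Complex (x + \<delta>) (y + \<delta>)))) f"
    and B: "\<And>w. w \<in> path_image (rectpath (Complex x y) (Complex (x + \<delta>) (y + \<delta>))) \<Longrightarrow> norm (f w) \<le> B"
    and "\<delta> > 0"
  shows "norm (contour_integral (rectpath (Complex x y) (Complex (x + \<delta>) (y + \<delta>))) f) \<le> 4 * \<delta> * B"
proof -
  let ?P = "path_image (rectpath (Complex x y) (Complex (x + \<delta>) (y + \<delta>)))"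
  have B0: "B \<ge> 0"
    using order_trans[OF norm_ge_zero B] pathstart_in_path_image[of "rectpath (Complex x y) (Complex (x + \<delta>) (y + \<delta>))"] by blast
  have side: "norm (contour_integral (linepath a b) f) \<le> \<delta> * B"
    if "closed_segment a b \<subseteq> ?P" "norm (b - a) = \<delta>" for a b
    using contour_integral_bound_linepath[of f a b B] that B B0 continuous_on_subset[OF cont that(1)]
    by (auto simp: contour_integrable_continuous_linepath mult.commute subset_iff)
  have P: "?P = closed_segment (Complex x y) (Complex (x + \<delta>) y) \<union>
      closed_segment (Complex (x + \<delta>) y) (Complex (x + \<delta>) (y + \<delta>)) \<union>
      closed_segment (Complex x (y + \<delta>)) (Complex (x + \<delta>) (y + \<delta>)) \<union>
      closed_segment (Complex x y) (Complex x (y + \<delta>))"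
    by (simp add: rectpath_def Let_def path_image_join closed_segment_commute Un_assoc)
  have n: "norm (Complex a b - Complex c d) = \<delta>" if "a - c = \<delta> \<and> b = d \<or> a = c \<and> b - d = \<delta>" for a b c d
    using that \<open>\<delta> > 0\<close> by (auto simp: cmod_def)
  have tri: "norm (a + b - c - d) \<le> norm a + norm b + norm c + norm d" for a b c d :: complex
    using norm_triangle_ineq4[of "a + b - c" d] norm_triangle_ineq4[of "a + b" c] norm_triangle_ineq[of a b]
    by linarith
  have "norm (contour_integral (linepath (Complex x y) (Complex (x + \<delta>) y)) f) \<le> \<delta> * B"
    "norm (contour_integral (linepath (Complex (x + \<delta>) y) (Complex (x + \<delta>) (y + \<delta>))) f) \<le> \<delta> * B"
    "norm (contour_integral (linepath (Complex x (y + \<delta>)) (Complex (x + \<delta>) (y + \<delta>))) f) \<le> \<delta> * B"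
    "norm (contour_integral (linepath (Complex x y) (Complex x (y + \<delta>))) f) \<le> \<delta> * B"
    by (rule side; use P n in auto)+
  then show ?thesis
    unfolding contour_integral_rectpath_sides[OF cont]
    by (intro order_trans[OF tri]) (simp add: algebra_simps)
qed

text \<open>Every inner edge is run through twice, in opposite directions.\<close>

lemma contour_integral_grid:
  fixes X Y :: "nat \<Rightarrow> real"
  assumes f: "continuous_on UNIV f" and "mono X" "mono Y"
  shows "(\<Sum>i<M. \<Sum>j<N. contour_integral
      (rectpath (Complex (X i) (Y j)) (Complex (X (Suc i)) (Y (Suc j)))) f)
    = contour_integral (rectpath (Complex (X 0) (Y 0)) (Complex (X M) (Y N))) f"
proof -
  define H where "H = (\<lambda>x x' y. contour_integral (linepath (Complex x y) (Complex x' y)) f)"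
  define V where "V = (\<lambda>x y y'. contour_integral (linepath (Complex x y) (Complex x y')) f)"
  have cont: "continuous_on S f" for S using f continuous_on_subset by blast
  have rect: "contour_integral (rectpath (Complex x y) (Complex x' y')) f =
      H x x' y + V x' y y' - H x x' y' - V x y y'" for x x' y y'
    unfolding H_def V_def by (rule contour_integral_rectpath_sides[OF cont])
  have H: "(\<Sum>i<n. H (X i) (X (Suc i)) y) = H (X 0) (X n) y" for n y
  proof (induction n)
    case (Suc n)
    have "H (X 0) (X (Suc n)) y = H (X 0) (X n) y + H (X n) (X (Suc n)) y"
      unfolding H_def
      by (rule contour_integral_split_linepath[OF cont])
        (use \<open>mono X\<close> in \<open>auto simp: closed_segment_same_Im closed_segment_eq_real_ivl mono_def\<close>)
    then show ?case using Suc by simp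
  qed (simp add: H_def)
  have V: "(\<Sum>j<n. V x (Y j) (Y (Suc j))) = V x (Y 0) (Y n)" for n x
  proof (induction n)
    case (Suc n)
    have "V x (Y 0) (Y (Suc n)) = V x (Y 0) (Y n) + V x (Y n) (Y (Suc n))"
      unfolding V_def
      by (rule contour_integral_split_linepath[OF cont])
        (use \<open>mono Y\<close> in \<open>auto simp: closed_segment_same_Re closed_segment_eq_real_ivl mono_def\<close>)
    then show ?case using Suc by simp
  qed (simp add: V_def)
  have "(\<Sum>j<N. contour_integral
      (rectpath (Complex (X i) (Y j)) (Complex (X (Suc i)) (Y (Suc j)))) f) =
    (\<Sum>j<N. H (X i) (X (Suc i)) (Y j) - H (X i) (X (Suc i)) (Y (Suc j)))
    + (\<Sum>j<N. V (X (Suc i)) (Y j) (Y (Suc j))) - (\<Sum>j<N. V (X i) (Y j) (Y (Suc j)))" for i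
    unfolding rect by (simp add: sum.distrib sum_subtractf)
  also have "\<dots> i = H (X i) (X (Suc i)) (Y 0) - H (X i) (X (Suc i)) (Y N)
      + (V (X (Suc i)) (Y 0) (Y N) - V (X i) (Y 0) (Y N))" for i
    unfolding V sum_lessThan_telescope'[of "\<lambda>j. H (X i) (X (Suc i)) (Y j)"] by simp
  finally have "(\<Sum>i<M. \<Sum>j<N. contour_integral
      (rectpath (Complex (X i) (Y j)) (Complex (X (Suc i)) (Y (Suc j)))) f) =
    (\<Sum>i<M. H (X i) (X (Suc i)) (Y 0)) - (\<Sum>i<M. H (X i) (X (Suc i)) (Y N))
      + (\<Sum>i<M. V (X (Suc i)) (Y 0) (Y N) - V (X i) (Y 0) (Y N))"
    by (simp add: sum.distrib sum_subtractf)
  also have "\<dots> = contour_integral (rectpath (Complex (X 0) (Y 0)) (Complex (X M) (Y N))) f"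
    unfolding rect H sum_lessThan_telescope[of "\<lambda>i. V (X i) (Y 0) (Y N)"] by simp
  finally show ?thesis .
qed

text \<open>Up to a factor \<open>2\<close>, \<open>x\<close> may be replaced by its integer part in \<open>1 + \<bar>x - i\<bar>\<close>, and then the sum is
  dominated by two copies of a convergent series.\<close>

lemma lattice_sum_bounded_1:
  "\<exists>C\<ge>0. \<forall>(x::real) N. (\<Sum>i<N. (1 + \<bar>x - real i\<bar>) powr (-3/2)) \<le> C"
proof -
  define g :: "nat \<Rightarrow> real" where "g = (\<lambda>m. ((1 + real m) / 2) powr (-3/2))"
  have "summable (\<lambda>m. real m powr (-3/2))" by (subst summable_real_powr_iff) simp
  then have "summable (\<lambda>m. (1/2) powr (-3/2) * real (Suc m) powr (-3/2))"
    by (intro summable_mult) (subst summable_Suc_iff)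
  also have "(\<lambda>m. (1/2) powr (-3/2) * real (Suc m) powr (-3/2)) = g"
    by (auto simp: g_def fun_eq_iff simp flip: powr_mult)
  finally have g: "summable g" .
  have g0: "g m \<ge> 0" for m by (simp add: g_def)
  have "(\<Sum>i<N. (1 + \<bar>x - real i\<bar>) powr (-3/2)) \<le> 2 * suminf g" for x :: real and N
  proof -
    define k where "k = \<lfloor>x\<rfloor>"
    have le: "(1 + \<bar>x - real i\<bar>) powr (-3/2) \<le> g (nat \<bar>int i - k\<bar>)" for i
    proof -
      have "real_of_int k \<le> x" "x < real_of_int k + 1" unfolding k_def by linarith+
      then have le1: "\<bar>real i - real_of_int k\<bar> \<le> \<bar>x - real i\<bar> + 1" by linarith
      have half: "(1 + a) / 2 \<le> 1 + b" if "a \<le> b + 1" "0 \<le> b" for a b :: real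
        using that by simp
      have "(1 + \<bar>real i - real_of_int k\<bar>) / 2 \<le> 1 + \<bar>x - real i\<bar>"
        by (rule half[OF le1 abs_ge_zero])
      moreover have "real (nat \<bar>int i - k\<bar>) = \<bar>real i - real_of_int k\<bar>" by simp
      ultimately show ?thesis unfolding g_def by (intro powr_mono2') auto
    qed
    have part: "(\<Sum>i\<in>I. (1 + \<bar>x - real i\<bar>) powr (-3/2)) \<le> suminf g"
      if "finite I" "inj_on (\<lambda>i. nat \<bar>int i - k\<bar>) I" for I
    proof -
      have "(\<Sum>i\<in>I. (1 + \<bar>x - real i\<bar>) powr (-3/2)) \<le> (\<Sum>i\<in>I. g (nat \<bar>int i - k\<bar>))"
        by (intro sum_mono le)
      also have "\<dots> = sum g ((\<lambda>i. nat \<bar>int i - k\<bar>) ` I)"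
        using that by (simp add: sum.reindex)
      also have "\<dots> \<le> suminf g" using that g g0 by (intro sum_le_suminf) auto
      finally show ?thesis .
    qed
    define I where "I = {i. i < N \<and> int i \<le> k}"
    define J where "J = {i. i < N \<and> int i > k}"
    have IJ: "{..<N} = I \<union> J" "finite I" "finite J" "I \<inter> J = {}" by (auto simp: I_def J_def)
    have "inj_on (\<lambda>i. nat \<bar>int i - k\<bar>) I" "inj_on (\<lambda>i. nat \<bar>int i - k\<bar>) J"
      by (auto simp: inj_on_def I_def J_def)
    note part[OF IJ(2) this(1)] part[OF IJ(3) this(2)]
    moreover have "(\<Sum>i<N. (1 + \<bar>x - real i\<bar>) powr (-3/2)) =
        (\<Sum>i\<in>I. (1 + \<bar>x - real i\<bar>) powr (-3/2)) + (\<Sum>i\<in>J. (1 + \<bar>x - real i\<bar>) powr (-3/2))"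
      unfolding IJ(1) by (rule sum.union_disjoint[OF IJ(2-4)])
    ultimately show ?thesis by linarith
  qed
  moreover have "suminf g \<ge> 0" using g g0 by (intro suminf_nonneg) auto
  ultimately show ?thesis by (intro exI[of _ "2 * suminf g"]) auto
qed

text \<open>The inequality \<open>(1 + t)\<^sup>2 \<ge> (1 + \<bar>x - i\<bar>) (1 + \<bar>y - j\<bar>)\<close> splits the cubic decay into a product of two
  summable one-dimensional factors.\<close>

lemma lattice_sum_bounded:
  "\<exists>C\<ge>0. \<forall>(x::real) (y::real) M N (t :: nat \<Rightarrow> nat \<Rightarrow> real).
    (\<forall>i j. \<bar>x - real i\<bar> \<le> t i j \<and> \<bar>y - real j\<bar> \<le> t i j)
      \<longrightarrow> (\<Sum>i<M. \<Sum>j<N. 1 / (1 + t i j) ^ 3) \<le> C"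
proof -
  obtain C where C: "C \<ge> 0" "\<And>(x::real) N. (\<Sum>i<N. (1 + \<bar>x - real i\<bar>) powr (-3/2)) \<le> C"
    using lattice_sum_bounded_1 by blast
  have "(\<Sum>i<M. \<Sum>j<N. 1 / (1 + t i j) ^ 3) \<le> C * C"
    if t: "\<forall>i j. \<bar>x - real i\<bar> \<le> t i j \<and> \<bar>y - real j\<bar> \<le> t i j" for x y :: real and M N t
  proof -
    have "1 / (1 + t i j) ^ 3 \<le> (1 + \<bar>x - real i\<bar>) powr (-3/2) * (1 + \<bar>y - real j\<bar>) powr (-3/2)" for i j
    proof -
      have t0: "t i j \<ge> 0" "\<bar>x - real i\<bar> \<le> t i j" "\<bar>y - real j\<bar> \<le> t i j"
        using t abs_ge_zero order_trans by blast+
      have "1 / (1 + t i j) ^ 3 = (1 + t i j) powr (-3)"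
        using t0 by (simp add: powr_minus powr_numeral divide_inverse)
      also have "\<dots> = (1 + t i j) powr (-3/2) * (1 + t i j) powr (-3/2)"
        by (simp flip: powr_add)
      also have "\<dots> \<le> (1 + \<bar>x - real i\<bar>) powr (-3/2) * (1 + \<bar>y - real j\<bar>) powr (-3/2)"
        using t0 by (intro mult_mono powr_mono2') auto
      finally show ?thesis .
    qed
    then have "(\<Sum>i<M. \<Sum>j<N. 1 / (1 + t i j) ^ 3) \<le>
        (\<Sum>i<M. \<Sum>j<N. (1 + \<bar>x - real i\<bar>) powr (-3/2) * (1 + \<bar>y - real j\<bar>) powr (-3/2))"
      by (intro sum_mono)
    also have "\<dots> = (\<Sum>i<M. (1 + \<bar>x - real i\<bar>) powr (-3/2)) * (\<Sum>j<N. (1 + \<bar>y - real j\<bar>) powr (-3/2))"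
      by (simp add: sum_product)
    also have "\<dots> \<le> C * C" using C by (intro mult_mono sum_nonneg) auto
    finally show ?thesis .
  qed
  then show ?thesis using C(1) by (intro exI[of _ "C * C"]) auto
qed

section \<open>Decomposition into Cauchy pieces\<close>

text \<open>The function \<open>1 / u\<close>, continuously modified on the disc of radius \<open>\<delta>\<close> so as to be bounded
  by \<open>1 / \<delta>\<close>.\<close>

definition soft_kernel :: "real \<Rightarrow> complex \<Rightarrow> complex" where
  "soft_kernel \<delta> u = cnj u / of_real ((max \<delta> (norm u))\<^sup>2)"

lemma soft_kernel_far: "\<delta> \<le> norm u \<Longrightarrow> soft_kernel \<delta> u = 1 / u"
  unfolding soft_kernel_def max.absorb2 complex_norm_square by (cases "u = 0") auto

lemma soft_kernel_bound: "\<delta> > 0 \<Longrightarrow> norm (soft_kernel \<delta> u) \<le> 1 / \<delta>"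
proof -
  assume "\<delta> > 0"
  define m where "m = max \<delta> (norm u)"
  have m: "m > 0" "norm u \<le> m" "\<delta> \<le> m" using \<open>\<delta> > 0\<close> by (auto simp: m_def)
  have "norm (soft_kernel \<delta> u) = norm u / m\<^sup>2"
    by (simp add: soft_kernel_def norm_divide norm_power m_def)
  also have "\<dots> \<le> m / m\<^sup>2" using m by (intro divide_right_mono) auto
  also have "\<dots> = 1 / m" by (simp add: power2_eq_square)
  also have "\<dots> \<le> 1 / \<delta>" using m \<open>\<delta> > 0\<close> by (intro divide_left_mono mult_pos_pos) auto
  finally show ?thesis .
qed

lemma continuous_on_soft_kernel:
  assumes "\<delta> > 0" shows "continuous_on S (\<lambda>w. soft_kernel \<delta> (w - z))"
proof -
  have "max \<delta> (norm (w - z)) \<noteq> 0" for w using assms by linarith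
  then have "of_real ((max \<delta> (norm (w - z)))\<^sup>2) \<noteq> (0 :: complex)" for w by (metis of_real_eq_0_iff power_eq_0_iff)
  then show ?thesis
    unfolding soft_kernel_def by (intro continuous_intros) blast
qed

lemma norm_cauchy_rectpath_le:
  assumes "continuous_on (path_image (rectpath (Complex x y) (Complex (x + \<delta>) (y + \<delta>)))) f"
    and "\<And>w. w \<in> path_image (rectpath (Complex x y) (Complex (x + \<delta>) (y + \<delta>))) \<Longrightarrow> norm (f w) \<le> B"
    and "\<delta> > 0"
  shows "norm (contour_integral (rectpath (Complex x y) (Complex (x + \<delta>) (y + \<delta>))) f / (2 * pi * \<i>)) \<le> \<delta> * B"
proof -
  have B0: "B \<ge> 0"
    using order_trans[OF norm_ge_zero assms(2)] pathstart_in_path_image[of "rectpath (Complex x y) (Complex (x + \<delta>) (y + \<delta>))"] by blast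
  have "norm (contour_integral (rectpath (Complex x y) (Complex (x + \<delta>) (y + \<delta>))) f / (2 * pi * \<i>))
      \<le> 4 * \<delta> * B / (2 * pi)"
    using divide_right_mono[OF contour_integral_rectpath_bound[OF assms], of "2 * pi"]
    by (simp add: norm_divide norm_mult)
  also have "\<dots> \<le> 4 * \<delta> * B / 4" 
    using pi_gt3 B0 \<open>\<delta> > 0\<close> by (intro divide_left_mono mult_nonneg_nonneg) auto
  finally show ?thesis by simp
qed

text \<open>The contribution of one grid square to a Cauchy integral of \<open>f\<close>. Subtracting \<open>f z\<close> makes the
  piece small for \<open>z\<close> near the square, where the kernel is large; away from the square it changes
  nothing, by Cauchy's theorem.\<close>

definition cauchy_piece ::
  "(complex \<Rightarrow> complex) \<Rightarrow> real \<Rightarrow> real \<Rightarrow> real \<Rightarrow> complex \<Rightarrow> complex" where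
  "cauchy_piece f \<delta> x y z = contour_integral (rectpath (Complex x y) (Complex (x + \<delta>) (y + \<delta>)))
     (\<lambda>w. (f w - f z) * soft_kernel \<delta> (w - z)) / (2 * pi * \<i>)"

context
  fixes x y \<delta> :: real and cell \<gamma> \<zeta>
  assumes \<delta>: "\<delta> > 0"
  defines "cell \<equiv> cbox (Complex x y) (Complex (x + \<delta>) (y + \<delta>))"
    and "\<gamma> \<equiv> rectpath (Complex x y) (Complex (x + \<delta>) (y + \<delta>))"
    and "\<zeta> \<equiv> Complex (x + \<delta> / 2) (y + \<delta> / 2)"
begin

lemma path_image_cell: "path_image \<gamma> \<subseteq> cell"
  unfolding \<gamma>_def cell_def using \<delta> by (intro path_image_rectpath_subset_cbox) auto

lemma centre_in_cell: "\<zeta> \<in> cell"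
  unfolding \<zeta>_def cell_def using \<delta> by (simp add: in_cbox_complex_iff)

lemma cell_near_centre:
  assumes "w \<in> cell" shows "norm (w - \<zeta>) < \<delta>"
proof -
  have "\<bar>Re (w - \<zeta>)\<bar> \<le> \<delta> / 2" "\<bar>Im (w - \<zeta>)\<bar> \<le> \<delta> / 2"
    using assms by (auto simp: cell_def in_cbox_complex_iff \<zeta>_def abs_le_iff field_simps)
  then have "(Re (w - \<zeta>))\<^sup>2 \<le> (\<delta> / 2)\<^sup>2" "(Im (w - \<zeta>))\<^sup>2 \<le> (\<delta> / 2)\<^sup>2"
    using \<delta> by (auto intro!: power2_le_iff_abs_le[THEN iffD2])
  then have "(norm (w - \<zeta>))\<^sup>2 \<le> (\<delta> / 2)\<^sup>2 + (\<delta> / 2)\<^sup>2" by (simp add: cmod_power2)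
  also have "\<dots> < \<delta>\<^sup>2" using \<delta> by (simp add: power2_eq_square)
  finally show ?thesis by (rule power2_less_imp_less) (use \<delta> in simp)
qed

lemma cell_cauchy_zero:
  assumes "f holomorphic_on cell" "z \<notin> cell"
  shows "((\<lambda>w. f w / (w - z)) has_contour_integral 0) \<gamma>"
proof (rule Cauchy_theorem_convex_simple[of _ cell])
  show "(\<lambda>w. f w / (w - z)) holomorphic_on cell"
    using assms by (intro holomorphic_intros) auto
  show "convex cell" unfolding cell_def by (rule convex_box)
qed (use path_image_cell in \<open>auto simp: \<gamma>_def\<close>)

text \<open>At distance \<open>2 \<delta>\<close> the kernel is the true Cauchy kernel on the square, so that the integral of a
  constant vanishes and any constant \<open>a\<close> may be subtracted instead of \<open>f z\<close>.\<close>

lemma cauchy_piece_far: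
  assumes f: "continuous_on UNIV f" and z: "norm (z - \<zeta>) \<ge> 2 * \<delta>"
  shows "cauchy_piece f \<delta> x y z = contour_integral \<gamma> (\<lambda>w. (f w - a) / (w - z)) / (2 * pi * \<i>)"
proof -
  have zc: "norm (w - z) \<ge> \<delta>" if "w \<in> cell" for w
    using cell_near_centre[OF that] z norm_triangle_ineq[of "z - w" "w - \<zeta>"]
    by (simp add: norm_minus_commute)
  then have "z \<notin> cell" using \<delta> by force
  have "((\<lambda>w. (f z - a) / (w - z)) has_contour_integral 0) \<gamma>"
    by (rule cell_cauchy_zero[OF _ \<open>z \<notin> cell\<close>]) auto
  moreover have "(\<lambda>w. (f w - f z) / (w - z)) contour_integrable_on \<gamma>"
    unfolding \<gamma>_def
    by (rule contour_integrable_rectpath)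
      (use f path_image_cell \<open>z \<notin> cell\<close> in
        \<open>auto simp: \<gamma>_def intro!: continuous_intros intro: continuous_on_subset\<close>)
  ultimately have "contour_integral \<gamma> (\<lambda>w. (f w - f z) / (w - z) + (f z - a) / (w - z))
      = contour_integral \<gamma> (\<lambda>w. (f w - f z) / (w - z))"
    by (subst contour_integral_add) (auto simp: has_contour_integral_integrable contour_integral_unique)
  moreover have "contour_integral \<gamma> (\<lambda>w. (f w - f z) * soft_kernel \<delta> (w - z))
      = contour_integral \<gamma> (\<lambda>w. (f w - f z) / (w - z))"
    using path_image_cell zc by (intro contour_integral_eq) (auto simp: soft_kernel_far)
  ultimately show ?thesis
    unfolding cauchy_piece_def \<gamma>_def[symmetric] by (simp flip: add_divide_distrib)
qed

lemma cauchy_piece_near: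
  assumes f: "continuous_on UNIV f" and z: "norm (z - \<zeta>) \<le> 6 * \<delta>"
    and \<omega>: "\<And>w. w \<in> cell \<Longrightarrow> norm (w - z) \<le> 7 * \<delta> \<Longrightarrow> norm (f w - f z) \<le> \<omega>"
  shows "norm (cauchy_piece f \<delta> x y z) \<le> \<omega>"
proof -
  have "norm (cauchy_piece f \<delta> x y z) \<le> \<delta> * (\<omega> * (1 / \<delta>))"
    unfolding cauchy_piece_def
  proof (rule norm_cauchy_rectpath_le[OF _ _ \<delta>])
    show "continuous_on (path_image (rectpath (Complex x y) (Complex (x + \<delta>) (y + \<delta>))))
        (\<lambda>w. (f w - f z) * soft_kernel \<delta> (w - z))"
      using f by (intro continuous_intros continuous_on_soft_kernel \<delta>) (auto intro: continuous_on_subset)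
    fix w assume "w \<in> path_image (rectpath (Complex x y) (Complex (x + \<delta>) (y + \<delta>)))"
    then have w: "w \<in> cell" using path_image_cell by (auto simp: \<gamma>_def)
    have "norm (w - z) \<le> 7 * \<delta>"
      using cell_near_centre[OF w] z norm_triangle_ineq4[of "w - \<zeta>" "z - \<zeta>"] by simp
    then have "norm (f w - f z) \<le> \<omega>" by (rule \<omega>[OF w])
    then show "norm ((f w - f z) * soft_kernel \<delta> (w - z)) \<le> \<omega> * (1 / \<delta>)"
      unfolding norm_mult using soft_kernel_bound[OF \<delta>, of "w - z"]
      by (intro mult_mono) (auto intro: order_trans[OF norm_ge_zero])
  qed
  then show ?thesis using \<delta> by simp
qed

end

context uniformly_closed_algebra
begin

text \<open>If the square lies in the interior of \<open>K\<close>, the piece vanishes at distance by Cauchy's theorem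
  and is at most \<open>\<omega>\<close> nearby, so that it is approximated by \<open>0\<close>. Otherwise there is a point \<open>p\<close> outside \<open>K\<close>
  within \<open>\<delta>\<close> of the centre; then the Cauchy kernel is replaced by the bounded kernel of the
  algebra belonging to \<open>p\<close>. The latter is affine in \<open>w\<close>, so the resulting integral is a combination
  of \<open>g\<close> and \<open>g\<^sup>2\<close>.\<close>

lemma cauchy_piece_approx:
  fixes x y \<delta> \<omega> :: real and f cell \<zeta>
  assumes conn: "connected (- K)" and f: "continuous_on UNIV f" "f holomorphic_on interior K"
    and \<delta>: "\<delta> > 0"
  defines "cell \<equiv> cbox (Complex x y) (Complex (x + \<delta>) (y + \<delta>))"
    and "\<zeta> \<equiv> Complex (x + \<delta> / 2) (y + \<delta> / 2)"
  assumes \<omega>: "\<And>w z. w \<in> cell \<Longrightarrow> z \<in> insert \<zeta> K \<Longrightarrow> norm (w - z) \<le> 7 * \<delta> \<Longrightarrow> norm (f w - f z) \<le> \<omega>"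
  shows "\<exists>F\<in>A. \<forall>z\<in>K. norm (cauchy_piece f \<delta> x y z - F z) \<le> 2007579 * \<omega> / (1 + norm (z - \<zeta>) / \<delta>) ^ 3"
proof -
  define \<gamma> where "\<gamma> = rectpath (Complex x y) (Complex (x + \<delta>) (y + \<delta>))"
  have cellI: "w \<in> cell" if "w \<in> path_image \<gamma>" for w
    using path_image_cell[OF \<delta>, of x y] that unfolding \<gamma>_def cell_def by blast
  have centre: "\<zeta> \<in> cell" unfolding \<zeta>_def cell_def by (rule centre_in_cell[OF \<delta>])
  have dist\<zeta>: "norm (w - \<zeta>) < \<delta>" if "w \<in> cell" for w
    using cell_near_centre[OF \<delta>] that unfolding \<zeta>_def cell_def by blast
  have "\<omega> \<ge> 0" using \<omega>[OF centre, of \<zeta>] \<delta> by auto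
  \<comment> \<open>Within distance \<open>6 \<delta>\<close> the decaying factor is at least \<open>7\<^sup>-\<^sup>3\<close>, and \<open>2007579 = 5853 * 7\<^sup>3\<close>,
    where \<open>5853 = 1 + (44 + 3 * 44\<^sup>2)\<close> collects the bounds for the piece and for its approximation.\<close>
  have near_bound: "a \<le> 2007579 * \<omega> / (1 + norm (z - \<zeta>) / \<delta>) ^ 3"
    if "a \<le> 5853 * \<omega>" "norm (z - \<zeta>) \<le> 6 * \<delta>" for a z
  proof -
    have t: "norm (z - \<zeta>) / \<delta> \<ge> 0" "norm (z - \<zeta>) / \<delta> \<le> 6" using that \<delta> by (auto simp: divide_simps)
    have "5853 * \<omega> = 2007579 * \<omega> / 7 ^ 3" by simp
    also have "\<dots> \<le> 2007579 * \<omega> / (1 + norm (z - \<zeta>) / \<delta>) ^ 3"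
      using t \<open>\<omega> \<ge> 0\<close> by (intro divide_left_mono power_mono mult_pos_pos) auto
    finally show ?thesis using that by linarith
  qed
  have piece_near: "norm (cauchy_piece f \<delta> x y z) \<le> \<omega>" if "z \<in> K" "norm (z - \<zeta>) \<le> 6 * \<delta>" for z
    using cauchy_piece_near[OF \<delta> f(1), of z x y \<omega>] \<omega> that unfolding cell_def \<zeta>_def by blast
  show ?thesis
  proof (cases "cell \<subseteq> interior K")
    case True
    show ?thesis
    proof (intro bexI ballI)
      fix z assume z: "z \<in> K"
      show "norm (cauchy_piece f \<delta> x y z - 0) \<le> 2007579 * \<omega> / (1 + norm (z - \<zeta>) / \<delta>) ^ 3"
      proof (cases "norm (z - \<zeta>) \<le> 6 * \<delta>")
        case True
        then show ?thesis using piece_near[OF z] \<open>\<omega> \<ge> 0\<close> by (intro near_bound) auto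
      next
        case False
        then have "z \<notin> cell" using dist\<zeta>[of z] \<delta> by auto
        have "f holomorphic_on cell" using f(2) \<open>cell \<subseteq> interior K\<close> by (rule holomorphic_on_subset)
        then have "contour_integral \<gamma> (\<lambda>w. (f w - 0) / (w - z)) = 0"
          using cell_cauchy_zero[OF \<delta>, of f x y z] \<open>z \<notin> cell\<close>
          unfolding cell_def \<gamma>_def by (simp add: contour_integral_unique)
        moreover have "2 * \<delta> \<le> norm (z - \<zeta>)" using False \<delta> by simp
        ultimately have "cauchy_piece f \<delta> x y z = 0"
          using cauchy_piece_far[OF \<delta> f(1), of z x y 0] unfolding \<gamma>_def \<zeta>_def by simp
        then show ?thesis using \<open>\<omega> \<ge> 0\<close> \<delta> by simp
      qed
    qed (rule const)
  next
    case False
    then obtain q where q: "q \<in> cell" "q \<notin> interior K" by auto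
    have "\<delta> - norm (q - \<zeta>) > 0" using dist\<zeta>[OF q(1)] by simp
    then have "\<not> ball q (\<delta> - norm (q - \<zeta>)) \<subseteq> K" using q(2) mem_interior by blast
    then obtain p where "p \<in> ball q (\<delta> - norm (q - \<zeta>))" and "p \<notin> K" by blast
    then have p: "p \<notin> K" "norm (q - p) < \<delta> - norm (q - \<zeta>)" by (simp_all add: dist_norm)
    have p\<zeta>: "norm (\<zeta> - p) \<le> \<delta>"
      using norm_triangle_ineq[of "\<zeta> - q" "q - p"] p by (simp add: norm_minus_commute)
    obtain c g where g: "g \<in> A" "norm (c - p) \<le> \<delta>" "\<And>z. z \<in> K \<Longrightarrow> norm (g z) \<le> 44 / \<delta>"
      "\<And>z w. z \<in> K \<Longrightarrow> norm (z - p) > 4 * \<delta> \<Longrightarrow> norm (w - p) \<le> 2 * \<delta> \<Longrightarrow>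
      norm (1 / (z - w) - (g z + (w - c) * (g z)\<^sup>2)) \<le> 60 * \<delta>\<^sup>2 / norm (z - p) ^ 3"
      by (rule exists_bounded_cauchy_kernel[OF conn p(1) \<delta>]) (rule that)
    define Q where "Q = (\<lambda>z w. g z + (w - c) * (g z)\<^sup>2)"
    define \<alpha> where "\<alpha> = contour_integral \<gamma> (\<lambda>w. f w - f \<zeta>)"
    define \<beta> where "\<beta> = contour_integral \<gamma> (\<lambda>w. (f w - f \<zeta>) * (w - c))"
    \<comment> \<open>The sign arises because the pieces use \<open>1 / (w - z)\<close> and the kernel approximates \<open>1 / (z - w)\<close>.\<close>
    define F where "F = (\<lambda>z. - 1 / (2 * pi * \<i>) * (\<alpha> * g z + \<beta> * (g z)\<^sup>2))"
    have contf: "continuous_on S f" for S using f(1) continuous_on_subset by blast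
    have int: "h contour_integrable_on \<gamma>" if "continuous_on (path_image \<gamma>) h" for h
      using contour_integrable_rectpath that unfolding \<gamma>_def by blast
    have F: "F z = contour_integral \<gamma> (\<lambda>w. - ((f w - f \<zeta>) * Q z w)) / (2 * pi * \<i>)" for z
    proof -
      have "contour_integral \<gamma> (\<lambda>w. - ((f w - f \<zeta>) * Q z w)) =
        contour_integral \<gamma> (\<lambda>w. (f w - f \<zeta>) * (- g z) + (f w - f \<zeta>) * (w - c) * (- (g z)\<^sup>2))"
        by (simp add: Q_def algebra_simps)
      also have "\<dots> = \<alpha> * (- g z) + \<beta> * (- (g z)\<^sup>2)"
        unfolding \<alpha>_def \<beta>_def
        by (intro contour_integral_unique has_contour_integral_add has_contour_integral_rmul
            has_contour_integral_integral int continuous_intros contf)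
      finally have eq: "contour_integral \<gamma> (\<lambda>w. - ((f w - f \<zeta>) * Q z w)) = \<alpha> * (- g z) + \<beta> * (- (g z)\<^sup>2)" .
      show ?thesis unfolding F_def eq by (simp add: divide_simps)
    qed
    have "F \<in> A" unfolding F_def by (intro mult add const power g(1))
    moreover have "norm (cauchy_piece f \<delta> x y z - F z) \<le> 2007579 * \<omega> / (1 + norm (z - \<zeta>) / \<delta>) ^ 3"
      if z: "z \<in> K" for z
    proof (cases "norm (z - \<zeta>) \<le> 6 * \<delta>")
      case True
      have "norm (F z) \<le> \<delta> * (\<omega> * (44 / \<delta> + 3 * \<delta> * (44 / \<delta>)\<^sup>2))"
        unfolding F \<gamma>_def
      proof (rule norm_cauchy_rectpath_le[OF _ _ \<delta>])
        fix w assume "w \<in> path_image (rectpath (Complex x y) (Complex (x + \<delta>) (y + \<delta>)))"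
        then have w: "w \<in> cell" using cellI by (simp add: \<gamma>_def)
        have "norm (w - c) \<le> 3 * \<delta>"
          using norm_triangle_ineq[of "w - \<zeta>" "\<zeta> - p"] norm_triangle_ineq4[of "w - p" "c - p"]
            dist\<zeta>[OF w] p\<zeta> g(2) by simp
        then have "norm (Q z w) \<le> 44 / \<delta> + 3 * \<delta> * (44 / \<delta>)\<^sup>2"
          unfolding Q_def using g(3)[OF z] \<delta>
          by (intro order_trans[OF norm_triangle_ineq] add_mono)
            (auto simp: norm_mult norm_power intro!: mult_mono power_mono)
        moreover have "norm (f w - f \<zeta>) \<le> \<omega>" using \<omega>[OF w, of \<zeta>] dist\<zeta>[OF w] \<delta> by simp
        ultimately show "norm (- ((f w - f \<zeta>) * Q z w)) \<le> \<omega> * (44 / \<delta> + 3 * \<delta> * (44 / \<delta>)\<^sup>2)"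
          unfolding norm_minus_cancel norm_mult using \<open>\<omega> \<ge> 0\<close> by (intro mult_mono) auto
      qed (auto simp: Q_def intro!: continuous_intros contf)
      also have "\<dots> = 5852 * \<omega>" using \<delta> by (simp add: field_simps power2_eq_square)
      finally have "norm (F z) \<le> 5852 * \<omega>" .
      then show ?thesis
        using piece_near[OF z True] norm_triangle_ineq4[of "cauchy_piece f \<delta> x y z" "F z"] True
        by (intro near_bound) auto
    next
      case False
      define T where "T = 1 + norm (z - \<zeta>) / \<delta>"
      have T: "T > 7" "norm (z - \<zeta>) = (T - 1) * \<delta>"
        using False \<delta> by (auto simp: T_def field_simps)
      have zp: "norm (z - p) \<ge> 5 / 7 * T * \<delta>" "norm (z - p) > 4 * \<delta>"
      proof -
        have "norm (z - p) \<ge> norm (z - \<zeta>) - \<delta>"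
          using norm_triangle_ineq[of "z - p" "p - \<zeta>"] p\<zeta> by (simp add: norm_minus_commute)
        then have *: "norm (z - p) \<ge> (T - 2) * \<delta>" using T by (simp add: algebra_simps)
        have "5 / 7 * T * \<delta> \<le> (T - 2) * \<delta>" using T \<delta> by (intro mult_right_mono) auto
        with * show "norm (z - p) \<ge> 5 / 7 * T * \<delta>" by linarith
        have "4 * \<delta> < (T - 2) * \<delta>" using T \<delta> by (intro mult_strict_right_mono) auto
        with * show "norm (z - p) > 4 * \<delta>" by linarith
      qed
      have zc: "z \<notin> cell" using False dist\<zeta>[of z] \<delta> by auto
      have "2 * \<delta> \<le> norm (z - \<zeta>)" using False \<delta> by simp
      then have piece: "cauchy_piece f \<delta> x y z = contour_integral \<gamma> (\<lambda>w. (f w - f \<zeta>) / (w - z)) / (2 * pi * \<i>)"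
        using cauchy_piece_far[OF \<delta> f(1), of z x y "f \<zeta>"] unfolding \<gamma>_def \<zeta>_def by simp
      have c1: "continuous_on (path_image \<gamma>) (\<lambda>w. (f w - f \<zeta>) / (w - z))"
        using cellI zc by (intro continuous_intros contf) auto
      have c2: "continuous_on (path_image \<gamma>) (\<lambda>w. - ((f w - f \<zeta>) * Q z w))"
        unfolding Q_def by (intro continuous_intros contf)
      have "cauchy_piece f \<delta> x y z - F z = 
          contour_integral \<gamma> (\<lambda>w. (f w - f \<zeta>) / (w - z) - - ((f w - f \<zeta>) * Q z w)) / (2 * pi * \<i>)"
        unfolding piece F contour_integral_diff[OF int[OF c1] int[OF c2]] by (rule diff_divide_distrib[symmetric])
      also have "norm \<dots> \<le> \<delta> * (\<omega> * (60 * \<delta>\<^sup>2 / norm (z - p) ^ 3))"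
        unfolding \<gamma>_def
      proof (rule norm_cauchy_rectpath_le[OF _ _ \<delta>])
        show "continuous_on (path_image (rectpath (Complex x y) (Complex (x + \<delta>) (y + \<delta>))))
            (\<lambda>w. (f w - f \<zeta>) / (w - z) - - ((f w - f \<zeta>) * Q z w))"
          using continuous_on_diff[OF c1 c2] by (simp add: \<gamma>_def)
        fix w assume "w \<in> path_image (rectpath (Complex x y) (Complex (x + \<delta>) (y + \<delta>)))"
        then have w: "w \<in> cell" using cellI by (simp add: \<gamma>_def)
        then have "w \<noteq> z" using zc by auto
        have eq: "(f w - f \<zeta>) / (w - z) - - ((f w - f \<zeta>) * Q z w) = - ((f w - f \<zeta>) * (1 / (z - w) - Q z w))"
          using \<open>w \<noteq> z\<close> by (simp add: divide_simps) (simp add: algebra_simps)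
        have "norm (w - p) \<le> 2 * \<delta>"
          using norm_triangle_ineq[of "w - \<zeta>" "\<zeta> - p"] dist\<zeta>[OF w] p\<zeta> by simp
        then have "norm (1 / (z - w) - Q z w) \<le> 60 * \<delta>\<^sup>2 / norm (z - p) ^ 3"
          unfolding Q_def by (intro g(4) z zp)
        moreover have "norm (f w - f \<zeta>) \<le> \<omega>" using \<omega>[OF w, of \<zeta>] dist\<zeta>[OF w] \<delta> by simp
        ultimately show "norm ((f w - f \<zeta>) / (w - z) - - ((f w - f \<zeta>) * Q z w))
            \<le> \<omega> * (60 * \<delta>\<^sup>2 / norm (z - p) ^ 3)"
          unfolding eq norm_minus_cancel norm_mult using \<open>\<omega> \<ge> 0\<close> by (intro mult_mono) auto
      qed
      also have "\<dots> = 60 * \<omega> * \<delta> ^ 3 / norm (z - p) ^ 3"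
        by (simp add: power2_eq_square power3_eq_cube)
      also have "\<dots> \<le> 60 * \<omega> * \<delta> ^ 3 / (5 / 7 * T * \<delta>) ^ 3"
        using zp T \<delta> \<open>\<omega> \<ge> 0\<close> by (intro divide_left_mono power_mono mult_pos_pos zero_less_power) auto
      also have "\<dots> = 60 * (7 / 5) ^ 3 * \<omega> / T ^ 3"
        using \<delta> T by (simp add: power_mult_distrib power_divide)
      also have "\<dots> \<le> 2007579 * \<omega> / T ^ 3"
        using T \<open>\<omega> \<ge> 0\<close> by (intro divide_right_mono mult_right_mono) (auto simp: power_divide)
      finally show ?thesis by (simp add: T_def)
    qed
    ultimately show ?thesis by blast
  qed
qed

end

section \<open>Mergelyan's theorem\<close>

lemma continuous_extension_compact_support:
  fixes f :: "complex \<Rightarrow> complex"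
  assumes "compact K" "continuous_on K f" "\<And>z. z \<in> K \<Longrightarrow> norm z < R"
  obtains g where "continuous_on UNIV g" "\<And>z. z \<in> K \<Longrightarrow> g z = f z" "\<And>z. norm z \<ge> R \<Longrightarrow> g z = 0"
proof -
  define S where "S = K \<union> {z. norm z \<ge> R}"
  define h where "h = (\<lambda>z. if z \<in> K then f z else 0)"
  have cl: "closed K" "closed {z::complex. norm z \<ge> R}"
    using assms(1) by (auto simp: compact_imp_closed intro!: closed_Collect_le continuous_intros)
  have "continuous_on S h"
    unfolding S_def h_def
    by (rule continuous_on_cases[OF cl assms(2)]) (use assms(3) in force)+
  moreover have "closedin (top_of_set UNIV) S"
    using cl by (simp add: S_def closed_Un)
  ultimately obtain g where "continuous_on UNIV g" "\<And>z. z \<in> S \<Longrightarrow> g z = h z"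
    by (rule Tietze_unbounded) (rule that)
  moreover have "h z = 0" if "norm z \<ge> R" for z using assms(3)[of z] that by (auto simp: h_def)
  ultimately show ?thesis
    by (intro that[of g]) (auto simp: S_def h_def)
qed

text \<open>The sum collapses to an integral over the boundary of the large square. There \<open>f\<close> vanishes and the
  kernel is \<open>1 / (w - z)\<close>, so that \<open>-f z\<close> times the winding number \<open>1\<close> is left.\<close>

lemma sum_cauchy_pieces:
  fixes \<delta> L :: real and N :: nat and f
  assumes f: "continuous_on UNIV f" "\<And>w. norm w \<ge> L \<Longrightarrow> f w = 0"
    and \<delta>: "\<delta> > 0" and N: "real N * \<delta> = 2 * L" and z: "norm z + \<delta> \<le> L"
  shows "(\<Sum>i<N. \<Sum>j<N. cauchy_piece f \<delta> (real i * \<delta> - L) (real j * \<delta> - L) z) = - f z"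
proof -
  define X where "X = (\<lambda>i. real i * \<delta> - L)"
  define \<Gamma> where "\<Gamma> = rectpath (Complex (- L) (- L)) (Complex L L)"
  define h where "h = (\<lambda>w. (f w - f z) * soft_kernel \<delta> (w - z))"
  have "L > 0" using z \<delta> norm_ge_zero[of z] by linarith
  have X: "X (Suc i) = X i + \<delta>" "X 0 = - L" "X N = L" for i
    using N by (simp_all add: X_def algebra_simps)
  have "mono X" using \<delta> by (auto simp: X_def mono_def)
  have h: "continuous_on UNIV h" unfolding h_def using f(1)
    by (intro continuous_intros continuous_on_soft_kernel \<delta>)
  have "(\<Sum>i<N. \<Sum>j<N. cauchy_piece f \<delta> (X i) (X j) z) =
      (\<Sum>i<N. \<Sum>j<N. contour_integral
        (rectpath (Complex (X i) (X j)) (Complex (X (Suc i)) (X (Suc j)))) h) / (2 * pi * \<i>)"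
    by (simp add: cauchy_piece_def h_def X(1) sum_divide_distrib)
  also have "\<dots> = contour_integral \<Gamma> h / (2 * pi * \<i>)"
    unfolding contour_integral_grid[OF h \<open>mono X\<close> \<open>mono X\<close>] X(2,3) \<Gamma>_def ..
  also have "contour_integral \<Gamma> h = contour_integral \<Gamma> (\<lambda>w. - f z * (1 / (w - z)))"
  proof (rule contour_integral_eq)
    fix w assume "w \<in> path_image \<Gamma>"
    then have "\<bar>Re w\<bar> = L \<or> \<bar>Im w\<bar> = L"
      using \<open>L > 0\<close> by (auto simp: \<Gamma>_def path_image_rectpath)
    then have "norm w \<ge> L" using abs_Re_le_cmod[of w] abs_Im_le_cmod[of w] by auto
    moreover from this have "norm (w - z) \<ge> \<delta>" using z norm_triangle_sub[of w z] by linarith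
    ultimately show "h w = - f z * (1 / (w - z))" using f(2) by (simp add: h_def soft_kernel_far)
  qed
  also have "contour_integral \<Gamma> (\<lambda>w. - f z * (1 / (w - z))) / (2 * pi * \<i>) = - f z * winding_number \<Gamma> z"
  proof -
    have zb: "z \<in> box (Complex (- L) (- L)) (Complex L L)"
      using z \<delta> abs_Re_le_cmod[of z] abs_Im_le_cmod[of z] by (auto simp: in_box_complex_iff)
    have notin: "z \<notin> path_image \<Gamma>"
      using zb by (auto simp: \<Gamma>_def path_image_rectpath in_box_complex_iff)
    have "continuous_on (path_image \<Gamma>) (\<lambda>w. 1 / (w - z))"
      using notin by (intro continuous_intros) auto
    then have "(\<lambda>w. 1 / (w - z)) contour_integrable_on \<Gamma>"
      unfolding \<Gamma>_def by (rule contour_integrable_rectpath)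
    then have "contour_integral \<Gamma> (\<lambda>w. - f z * (1 / (w - z))) = - f z * contour_integral \<Gamma> (\<lambda>w. 1 / (w - z))"
      by (rule contour_integral_lmul)
    moreover have "winding_number \<Gamma> z = 1 / (2 * pi * \<i>) * contour_integral \<Gamma> (\<lambda>w. 1 / (w - z))"
      using notin unfolding \<Gamma>_def by (intro winding_number_valid_path) auto
    ultimately show ?thesis by simp
  qed
  also have "winding_number \<Gamma> z = 1"
    unfolding \<Gamma>_def
    by (rule winding_number_rectpath)
      (use z \<delta> abs_Re_le_cmod[of z] abs_Im_le_cmod[of z] in \<open>auto simp: in_box_complex_iff\<close>)
  finally show ?thesis by (simp add: X_def)
qed

context uniformly_closed_algebra
begin

text \<open>Mergelyan's theorem, for an arbitrary uniformly closed algebra containing the coordinate function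
  in place of the uniform closure of the polynomials. Each of the Cauchy pieces of \<open>f\<close> is replaced
  by its approximation in the algebra. If \<open>\<omega>\<close> bounds the oscillation of \<open>f\<close> at the scale of the
  grid, the errors add up to a constant times \<open>\<omega>\<close>, whatever the number of squares.\<close>

theorem mergelyan:
  assumes conn: "connected (- K)" and cont: "continuous_on K f" and hol: "f holomorphic_on interior K"
  shows "f \<in> A"
proof (rule uniformly_closed)
  fix e :: real assume "e > 0"
  obtain B where B: "B > 0" "\<And>z. z \<in> K \<Longrightarrow> norm z \<le> B"
    using compact_imp_bounded[OF compact_K] by (auto simp: bounded_pos)
  define L where "L = B + 1"
  obtain g where g: "continuous_on UNIV g" "\<And>z. z \<in> K \<Longrightarrow> g z = f z" "\<And>z. norm z \<ge> L \<Longrightarrow> g z = 0"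
    by (rule continuous_extension_compact_support[OF compact_K cont, of L]) (use B in \<open>force simp: L_def\<close>)+
  have "g holomorphic_on interior K"
    using hol by (rule holomorphic_transform) (metis g(2) interior_subset subsetD)
  obtain C :: real where C: "C \<ge> 0" "\<And>x y M N (t :: nat \<Rightarrow> nat \<Rightarrow> real).
      (\<And>i j. \<bar>x - real i\<bar> \<le> t i j \<and> \<bar>y - real j\<bar> \<le> t i j) \<Longrightarrow>
      (\<Sum>i<M. \<Sum>j<N. 1 / (1 + t i j) ^ 3) \<le> C"
    using lattice_sum_bounded by blast
  define \<omega> where "\<omega> = e / (2007579 * C + 1)"
  have "\<omega> > 0" using \<open>e > 0\<close> C(1) by (simp add: \<omega>_def add_nonneg_pos)
  define box where "box = cbox (Complex (- L) (- L)) (Complex L L)"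
  have "uniformly_continuous_on box g"
    unfolding box_def using g(1) by (intro compact_uniformly_continuous continuous_on_subset[OF g(1)]) auto
  then obtain \<eta> where \<eta>: "\<eta> > 0" "\<And>w z. w \<in> box \<Longrightarrow> z \<in> box \<Longrightarrow> dist w z < \<eta> \<Longrightarrow> dist (g w) (g z) < \<omega>"
    using \<open>\<omega> > 0\<close> unfolding uniformly_continuous_on_def by metis
  \<comment> \<open>The mesh must not exceed \<open>1\<close>, since \<open>K\<close> has at least this distance from the boundary of the large
    square, and distances up to \<open>7 \<delta>\<close> must be less than \<open>\<eta>\<close>.\<close>
  define m where "m = max 1 (8 / \<eta>)"
  obtain N :: nat where N: "real N > 2 * L * m" using reals_Archimedean2 by blast
  define \<delta> where "\<delta> = 2 * L / real N"
  have "L > 0" "m \<ge> 1" "m \<ge> 8 / \<eta>" using B by (simp_all add: L_def m_def)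
  have "real N > 0" using N \<open>L > 0\<close> \<open>m \<ge> 1\<close> by (smt (verit) mult_nonneg_nonneg)
  have \<delta>: "\<delta> > 0" "real N * \<delta> = 2 * L" using \<open>L > 0\<close> \<open>real N > 0\<close> by (auto simp: \<delta>_def)
  have \<delta>m: "\<delta> * m < 1" using N \<open>real N > 0\<close> by (simp add: \<delta>_def divide_simps)
  have \<delta>1: "\<delta> \<le> 1"
    using mult_left_mono[OF \<open>m \<ge> 1\<close>, of \<delta>] \<delta>m \<delta>(1) by linarith
  have "\<delta> * (8 / \<eta>) < 1"
    using mult_left_mono[OF \<open>m \<ge> 8 / \<eta>\<close>, of \<delta>] \<delta>m \<delta>(1) by linarith
  then have \<delta>\<eta>: "8 * \<delta> < \<eta>" using \<eta>(1) by (simp add: divide_simps mult.commute)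
  define X where "X = (\<lambda>i. real i * \<delta> - L)"
  define \<zeta> where "\<zeta> = (\<lambda>i j. Complex (X i + \<delta> / 2) (X j + \<delta> / 2))"
  define W where "W = (\<lambda>i j. cauchy_piece g \<delta> (X i) (X j))"
  have cell: "cbox (Complex (X i) (X j)) (Complex (X i + \<delta>) (X j + \<delta>)) \<subseteq> box" if "i < N" "j < N" for i j
  proof -
    have "X k \<ge> - L \<and> X k + \<delta> \<le> L" if "k < N" for k
    proof -
      have "(real k + 1) * \<delta> \<le> real N * \<delta>" using that \<delta>(1) by (intro mult_right_mono) auto
      then show ?thesis using \<delta> by (simp add: X_def algebra_simps)
    qed
    from this[OF that(1)] this[OF that(2)] show ?thesis
      by (auto simp: box_def in_cbox_complex_iff)
  qed
  have K_box: "z \<in> box" if "z \<in> K" for z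
    using B(2)[OF that] abs_Re_le_cmod[of z] abs_Im_le_cmod[of z] by (auto simp: box_def in_cbox_complex_iff L_def)
  have "\<exists>F\<in>A. \<forall>z\<in>K. norm (W i j z - F z) \<le> 2007579 * \<omega> / (1 + norm (z - \<zeta> i j) / \<delta>) ^ 3"
    if ij: "i < N" "j < N" for i j
    unfolding W_def \<zeta>_def
  proof (rule cauchy_piece_approx[OF conn g(1) \<open>g holomorphic_on interior K\<close> \<delta>(1)])
    fix w z assume w: "w \<in> cbox (Complex (X i) (X j)) (Complex (X i + \<delta>) (X j + \<delta>))"
      and z: "z \<in> insert (Complex (X i + \<delta> / 2) (X j + \<delta> / 2)) K" and wz: "norm (w - z) \<le> 7 * \<delta>"
    have "z \<in> box" using z K_box cell[OF ij] centre_in_cell[OF \<delta>(1)] by blast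
    moreover have "w \<in> box" using w cell[OF ij] by blast
    ultimately show "norm (g w - g z) \<le> \<omega>"
      using \<eta>(2)[of w z] wz \<delta>\<eta> \<delta>(1) by (simp add: dist_norm)
  qed
  then obtain F where F: "\<And>i j. i < N \<Longrightarrow> j < N \<Longrightarrow> F i j \<in> A"
    "\<And>i j z. i < N \<Longrightarrow> j < N \<Longrightarrow> z \<in> K \<Longrightarrow> norm (W i j z - F i j z) \<le> 2007579 * \<omega> / (1 + norm (z - \<zeta> i j) / \<delta>) ^ 3"
    by metis
  define G where "G = (\<lambda>z. (-1) * (\<Sum>i<N. \<Sum>j<N. F i j z))"
  have "G \<in> A" unfolding G_def by (intro mult const sum F(1)) auto
  moreover have "norm (f z - G z) < e" if z: "z \<in> K" for z
  proof -
    have "(\<Sum>i<N. \<Sum>j<N. W i j z) = - g z"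
      unfolding W_def X_def using B(2)[OF z] \<delta>1
      by (intro sum_cauchy_pieces g \<delta>) (auto simp: L_def)
    then have "f z - G z = - (\<Sum>i<N. \<Sum>j<N. W i j z - F i j z)"
      using g(2)[OF z] by (simp add: G_def sum_subtractf)
    then have "norm (f z - G z) = norm (\<Sum>i<N. \<Sum>j<N. W i j z - F i j z)" by simp
    also have "\<dots> \<le> (\<Sum>i<N. \<Sum>j<N. 2007579 * \<omega> * (1 / (1 + norm (z - \<zeta> i j) / \<delta>) ^ 3))"
      by (intro order_trans[OF norm_sum] sum_mono) (use F(2) z in auto)
    also have "\<dots> = 2007579 * \<omega> * (\<Sum>i<N. \<Sum>j<N. 1 / (1 + norm (z - \<zeta> i j) / \<delta>) ^ 3)"
      by (simp only: sum_distrib_left)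
    also have "\<dots> \<le> 2007579 * \<omega> * C"
    proof (intro mult_left_mono C(2)[of "(Re z + L) / \<delta> - 1 / 2" _ "(Im z + L) / \<delta> - 1 / 2"] conjI)
      fix i j :: nat
      have "Re (z - \<zeta> i j) / \<delta> = (Re z + L) / \<delta> - 1 / 2 - real i" 
        "Im (z - \<zeta> i j) / \<delta> = (Im z + L) / \<delta> - 1 / 2 - real j"
        using \<delta>(1) by (simp_all add: \<zeta>_def X_def field_simps)
      moreover have "\<bar>Re (z - \<zeta> i j) / \<delta>\<bar> \<le> norm (z - \<zeta> i j) / \<delta>" "\<bar>Im (z - \<zeta> i j) / \<delta>\<bar> \<le> norm (z - \<zeta> i j) / \<delta>"
        using \<delta>(1) abs_Re_le_cmod[of "z - \<zeta> i j"] abs_Im_le_cmod[of "z - \<zeta> i j"]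
        by (auto simp: abs_divide intro!: divide_right_mono)
      ultimately show "\<bar>(Re z + L) / \<delta> - 1 / 2 - real i\<bar> \<le> norm (z - \<zeta> i j) / \<delta>"
         "\<bar>(Im z + L) / \<delta> - 1 / 2 - real j\<bar> \<le> norm (z - \<zeta> i j) / \<delta>" by simp_all
    qed (use \<open>\<omega> > 0\<close> in auto)
    also have "\<dots> < e"
    proof -
      have "\<omega> * (2007579 * C + 1) = e" using C(1) by (simp add: \<omega>_def)
      then show ?thesis using \<open>\<omega> > 0\<close> by (simp add: algebra_simps)
    qed
    finally show ?thesis .
  qed
  ultimately show "\<exists>G\<in>A. \<forall>z\<in>K. norm (f z - G z) < e" by blast
qed

end

section \<open>The algebra of Dirichlet polynomials\<close>

lemma inverse_nat_powr: "n \<ge> 1 \<Longrightarrow> 1 / of_nat n powr s = exp (- (of_real (ln (real n)) * s))" for s :: complex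
  by (simp add: powr_def exp_minus divide_inverse Ln_of_nat mult.commute)

definition dirichlet_polys :: "(complex \<Rightarrow> complex) set" where
  "dirichlet_polys = {P. \<exists>N a. P = dirichlet_poly N a}"

lemma dirichlet_poly_extend:
  assumes "N \<le> M"
  shows "dirichlet_poly N a = dirichlet_poly M (\<lambda>n. if n \<le> N then a n else 0)"
proof
  fix s
  have "(\<Sum>n=1..M. (if n \<le> N then a n else 0) * (1 / of_nat n powr s)) =
      (\<Sum>n=1..N. (if n \<le> N then a n else 0) * (1 / of_nat n powr s))"
    using assms by (intro sum.mono_neutral_right) auto
  then show "dirichlet_poly N a s = dirichlet_poly M (\<lambda>n. if n \<le> N then a n else 0) s"
    by (simp add: dirichlet_poly_def)
qed

lemma dirichlet_polys_add:
  assumes "f \<in> dirichlet_polys" "g \<in> dirichlet_polys"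
  shows "(\<lambda>s. f s + g s) \<in> dirichlet_polys"
proof -
  obtain N a M b where "f = dirichlet_poly N a" "g = dirichlet_poly M b"
    using assms by (auto simp: dirichlet_polys_def)
  then obtain a' b' where fg: "f = dirichlet_poly (max N M) a'" "g = dirichlet_poly (max N M) b'"
    using dirichlet_poly_extend[of N "max N M" a] dirichlet_poly_extend[of M "max N M" b] by auto
  have "(\<lambda>s. f s + g s) = dirichlet_poly (max N M) (\<lambda>n. a' n + b' n)"
    by (simp add: fg dirichlet_poly_def fun_eq_iff sum.distrib add_divide_distrib)
  then show ?thesis by (auto simp: dirichlet_polys_def)
qed

lemma dirichlet_polys_term:
  assumes "n \<ge> 1" shows "(\<lambda>s. c * exp (- (of_real (ln (real n)) * s))) \<in> dirichlet_polys"
proof -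
  have "dirichlet_poly n (\<lambda>k. if k = n then c else 0) s = c * exp (- (of_real (ln (real n)) * s))" for s
  proof -
    have "dirichlet_poly n (\<lambda>k. if k = n then c else 0) s = (\<Sum>k\<in>{1..n}. if k = n then c * (1 / of_nat k powr s) else 0)"
      unfolding dirichlet_poly_def by (intro sum.cong) auto
    also have "\<dots> = c * (1 / of_nat n powr s)" using assms by (subst sum.delta) auto
    finally show ?thesis using inverse_nat_powr[OF assms] by simp
  qed
  then have "(\<lambda>s. c * exp (- (of_real (ln (real n)) * s))) = dirichlet_poly n (\<lambda>k. if k = n then c else 0)"
    by (simp add: fun_eq_iff)
  then show ?thesis unfolding dirichlet_polys_def by blast
qed

lemma dirichlet_polys_const: "(\<lambda>_. c) \<in> dirichlet_polys"
  using dirichlet_polys_term[of 1 c] by simp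

lemma dirichlet_polys_sum:
  assumes "\<And>i. i \<in> I \<Longrightarrow> f i \<in> dirichlet_polys" "finite I"
  shows "(\<lambda>s. \<Sum>i\<in>I. f i s) \<in> dirichlet_polys"
  using assms(2,1) by (induction I rule: finite_induct) (auto intro: dirichlet_polys_add dirichlet_polys_const)

text \<open>Products of terms are terms because \<open>ln n + ln m = ln (n m)\<close>.\<close>

lemma dirichlet_polys_mult:
  assumes "f \<in> dirichlet_polys" "g \<in> dirichlet_polys"
  shows "(\<lambda>s. f s * g s) \<in> dirichlet_polys"
proof -
  obtain N a M b where fg: "f = dirichlet_poly N a" "g = dirichlet_poly M b"
    using assms by (auto simp: dirichlet_polys_def)
  have "f s * g s = (\<Sum>n=1..N. \<Sum>m=1..M. a n * b m * exp (- (of_real (ln (real (n * m))) * s)))" for s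
    unfolding fg dirichlet_poly_def sum_product
  proof (intro sum.cong refl)
    fix n m :: nat assume "n \<in> {1..N}" "m \<in> {1..M}"
    then have nm: "n \<ge> 1" "m \<ge> 1" by auto
    have "- (of_real (ln (real (n * m))) * s) = - (of_real (ln (real n)) * s) + - (of_real (ln (real m)) * s)"
      using nm by (simp add: ln_mult algebra_simps)
    then show "a n * (1 / of_nat n powr s) * (b m * (1 / of_nat m powr s)) =
        a n * b m * exp (- (of_real (ln (real (n * m))) * s))"
      by (simp only: inverse_nat_powr[OF nm(1)] inverse_nat_powr[OF nm(2)] exp_add ac_simps)
  qed
  then show ?thesis
    by (simp only:) (intro dirichlet_polys_sum dirichlet_polys_term, auto)
qed

lemma continuous_on_dirichlet_polys:
  assumes "f \<in> dirichlet_polys" shows "continuous_on S f"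
proof -
  obtain N a where f: "f = dirichlet_poly N a" using assms by (auto simp: dirichlet_polys_def)
  have "f = (\<lambda>s. \<Sum>n=1..N. a n * exp (- (of_real (ln (real n)) * s)))"
    unfolding f dirichlet_poly_def by (auto simp: fun_eq_iff inverse_nat_powr intro!: sum.cong)
  then show ?thesis by (simp only:) (intro continuous_intros)
qed

definition dirichlet_closure :: "complex set \<Rightarrow> (complex \<Rightarrow> complex) set" where
  "dirichlet_closure K = {f. \<forall>e>0. \<exists>P\<in>dirichlet_polys. \<forall>z\<in>K. norm (f z - P z) < e}"

lemma dirichlet_closure_add:
  assumes "f \<in> dirichlet_closure K" "g \<in> dirichlet_closure K"
  shows "(\<lambda>z. f z + g z) \<in> dirichlet_closure K"
  unfolding dirichlet_closure_def
proof (safe)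
  fix e :: real assume "e > 0"
  then have "e / 2 > 0" by simp
  then obtain P Q where P: "P \<in> dirichlet_polys" "\<And>z. z \<in> K \<Longrightarrow> norm (f z - P z) < e / 2"
    and Q: "Q \<in> dirichlet_polys" "\<And>z. z \<in> K \<Longrightarrow> norm (g z - Q z) < e / 2"
    using assms unfolding dirichlet_closure_def by blast
  show "\<exists>P\<in>dirichlet_polys. \<forall>z\<in>K. norm (f z + g z - P z) < e"
  proof (intro bexI ballI)
    fix z assume z: "z \<in> K"
    have "f z + g z - (P z + Q z) = (f z - P z) + (g z - Q z)" by simp
    also have "norm \<dots> < e" using P(2)[OF z] Q(2)[OF z] norm_triangle_ineq[of "f z - P z" "g z - Q z"] by simp
    finally show "norm (f z + g z - (P z + Q z)) < e" .
  qed (intro dirichlet_polys_add P Q)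
qed

lemma dirichlet_closure_mult:
  assumes "compact K" "f \<in> dirichlet_closure K" "g \<in> dirichlet_closure K"
  shows "(\<lambda>z. f z * g z) \<in> dirichlet_closure K"
  unfolding dirichlet_closure_def
proof (safe)
  fix e :: real assume "e > 0"
  have bounded: "\<exists>B>0. \<forall>z\<in>K. norm (h z) \<le> B" if "h \<in> dirichlet_polys" for h
    using compact_imp_bounded[OF compact_continuous_image[OF continuous_on_dirichlet_polys[OF that] assms(1)]]
    by (auto simp: bounded_pos)
  obtain Q0 where Q0: "Q0 \<in> dirichlet_polys" "\<And>z. z \<in> K \<Longrightarrow> norm (g z - Q0 z) < 1"
    using assms(3) zero_less_one unfolding dirichlet_closure_def by blast
  obtain B where B: "B > 0" "\<And>z. z \<in> K \<Longrightarrow> norm (Q0 z) \<le> B" using bounded[OF Q0(1)] by blast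
  have gB: "norm (g z) \<le> B + 1" if "z \<in> K" for z
    using Q0(2)[OF that] B(2)[OF that] norm_triangle_sub[of "g z" "Q0 z"] by simp
  have "e / (4 * (B + 1)) > 0" using \<open>e > 0\<close> B by simp
  then obtain P where P: "P \<in> dirichlet_polys" "\<And>z. z \<in> K \<Longrightarrow> norm (f z - P z) < e / (4 * (B + 1))"
    using assms(2) unfolding dirichlet_closure_def by blast
  obtain C where C: "C > 0" "\<And>z. z \<in> K \<Longrightarrow> norm (P z) \<le> C" using bounded[OF P(1)] by blast
  have "e / (2 * C) > 0" using \<open>e > 0\<close> C by simp
  then obtain Q where Q: "Q \<in> dirichlet_polys" "\<And>z. z \<in> K \<Longrightarrow> norm (g z - Q z) < e / (2 * C)"
    using assms(3) unfolding dirichlet_closure_def by blast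
  show "\<exists>P\<in>dirichlet_polys. \<forall>z\<in>K. norm (f z * g z - P z) < e"
  proof (intro bexI ballI)
    fix z assume z: "z \<in> K"
    have "norm (f z - P z) * norm (g z) \<le> e / (4 * (B + 1)) * (B + 1)"
      using less_imp_le[OF P(2)[OF z]] gB[OF z] B(1) \<open>e > 0\<close> by (intro mult_mono) auto
    also have "\<dots> = e / 4" using B(1) by (simp add: field_simps)
    finally have 1: "norm ((f z - P z) * g z) \<le> e / 4" by (simp add: norm_mult)
    have "norm (P z) * norm (g z - Q z) \<le> C * (e / (2 * C))"
      using C(2)[OF z] less_imp_le[OF Q(2)[OF z]] C(1) by (intro mult_mono) auto
    also have "\<dots> = e / 2" using C(1) by simp
    finally have 2: "norm (P z * (g z - Q z)) \<le> e / 2" by (simp add: norm_mult)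
    have "f z * g z - P z * Q z = (f z - P z) * g z + P z * (g z - Q z)" by (simp add: algebra_simps)
    also have "norm \<dots> < e" using 1 2 \<open>e > 0\<close> norm_triangle_ineq[of "(f z - P z) * g z" "P z * (g z - Q z)"] by simp
    finally show "norm (f z * g z - P z * Q z) < e" .
  qed (intro dirichlet_polys_mult P Q)
qed

lemma dirichlet_closure_closed:
  assumes "\<And>e. e > 0 \<Longrightarrow> \<exists>g\<in>dirichlet_closure K. \<forall>z\<in>K. norm (f z - g z) < e"
  shows "f \<in> dirichlet_closure K"
  unfolding dirichlet_closure_def
proof (safe)
  fix e :: real assume "e > 0"
  then have "e / 2 > 0" by simp
  then obtain g where g: "g \<in> dirichlet_closure K" "\<And>z. z \<in> K \<Longrightarrow> norm (f z - g z) < e / 2"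
    using assms by blast
  then obtain P where P: "P \<in> dirichlet_polys" "\<And>z. z \<in> K \<Longrightarrow> norm (g z - P z) < e / 2"
    using \<open>e / 2 > 0\<close> unfolding dirichlet_closure_def by blast
  show "\<exists>P\<in>dirichlet_polys. \<forall>z\<in>K. norm (f z - P z) < e"
  proof (intro bexI[OF _ P(1)] ballI)
    fix z assume z: "z \<in> K"
    show "norm (f z - P z) < e"
      using g(2)[OF z] P(2)[OF z] norm_triangle_ineq[of "f z - g z" "g z - P z"] by simp
  qed
qed

section \<open>The coordinate function as a limit of Dirichlet polynomials\<close>

text \<open>Approximation of \<open>s\<close> by exponentials with given frequencies, in the spirit of Golitschek's proof of the
  Muentz theorem. If \<open>Q\<close> is the error for the first frequencies and \<open>L\<close> is the next one, the solution of
  \<open>E' + L E = L Q\<close> with \<open>E 0 = 0\<close> is again \<open>s\<close> minus a combination of exponentials, and integrating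
  the equation along the segment from \<open>0\<close> to \<open>s\<close> gains a factor \<open>L \<bar>s\<bar> / (n + 2)\<close>.\<close>

lemma identity_minus_exponentials:
  fixes l :: "nat \<Rightarrow> real"
  assumes "strict_mono l" "l 0 = 0"
  shows "\<exists>c. \<forall>s::complex. norm (s - (\<Sum>k\<le>n. c k * exp (- (of_real (l k) * s)))) \<le>
    (\<Prod>k=1..n. l k) * norm s ^ Suc n / fact (Suc n) * exp (l n * norm s)"
proof (induction n)
  case 0
  show ?case using \<open>l 0 = 0\<close> by (intro exI[of _ "\<lambda>_. 0"]) simp
next
  case (Suc n)
  define P where "P = (\<Prod>k=1..n. l k)"
  obtain c where c: "\<And>s::complex. norm (s - (\<Sum>k\<le>n. c k * exp (- (of_real (l k) * s)))) \<le>
    P * norm s ^ Suc n / fact (Suc n) * exp (l n * norm s)" using Suc unfolding P_def by blast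
  define Q where "Q = (\<lambda>s. s - (\<Sum>k\<le>n. c k * exp (- (of_real (l k) * s))))"
  define L where "L = l (Suc n)"
  have l_less: "l k < L" if "k \<le> n" for k
    using that assms(1) by (auto simp: L_def strict_mono_def)
  have l_pos: "l k \<ge> 0" for k
    using assms strict_mono_less_eq[OF assms(1), of 0 k] by simp
  have "L > 0" using l_less[of 0] assms by simp
  have "P \<ge> 0" unfolding P_def using l_pos by (intro prod_nonneg) auto
  \<comment> \<open>The particular solution \<open>D\<close>: the term of frequency \<open>l k\<close> is multiplied by \<open>L / (L - l k)\<close>, and \<open>s\<close>
    contributes \<open>s - 1 / L\<close>, whose constant goes to the frequency \<open>l 0 = 0\<close>. Subtracting
    \<open>D 0\<close> times the exponential of frequency \<open>L\<close> gives \<open>E\<close>.\<close>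
  define d where "d = (\<lambda>k. c k * of_real (L / (L - l k)) + (if k = 0 then of_real (1 / L) else 0))"
  define D where "D = (\<lambda>s. s - (\<Sum>k\<le>n. d k * exp (- (of_real (l k) * s))))"
  define E where "E = (\<lambda>s. D s - D 0 * exp (- (of_real L * s)))"
  have D_ode: "(D has_field_derivative (of_real L * (Q s - D s))) (at s)" for s
  proof -
    have "(D has_field_derivative (1 - (\<Sum>k\<le>n. d k * (exp (- (of_real (l k) * s)) * (- of_real (l k)))))) (at s)"
      unfolding D_def by (auto intro!: derivative_eq_intros sum.cong simp: mult_ac)
    moreover have "1 - (\<Sum>k\<le>n. d k * (exp (- (of_real (l k) * s)) * (- of_real (l k)))) = of_real L * (Q s - D s)"
    proof -
      have "(\<Sum>k\<le>n. d k * (exp (- (of_real (l k) * s)) * (- of_real (l k)))) =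
          (\<Sum>k\<le>n. of_real L * c k * exp (- (of_real (l k) * s)) 
            - of_real L * d k * exp (- (of_real (l k) * s)) + (if k = 0 then 1 else 0))"
      proof (rule sum.cong[OF refl])
        fix k assume "k \<in> {..n}"
        then have "L - l k \<noteq> 0" using l_less[of k] by simp
        then have "of_real L - of_real (l k) \<noteq> (0::complex)" by (metis of_real_diff of_real_eq_0_iff)
        then have "d k * (of_real L - of_real (l k)) = of_real L * c k + (if k = 0 then 1 else 0)"
          using \<open>L > 0\<close> \<open>l 0 = 0\<close> by (auto simp: d_def field_simps)
        then have "d k * (- of_real (l k)) = of_real L * c k - of_real L * d k + (if k = 0 then 1 else 0)"
          by (simp add: algebra_simps)
        then have "d k * (- of_real (l k)) * exp (- (of_real (l k) * s)) =
           (of_real L * c k - of_real L * d k + (if k = 0 then 1 else 0)) * exp (- (of_real (l k) * s))"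
          by simp
        then show "d k * (exp (- (of_real (l k) * s)) * (- of_real (l k))) =
            of_real L * c k * exp (- (of_real (l k) * s)) 
            - of_real L * d k * exp (- (of_real (l k) * s)) + (if k = 0 then 1 else 0)"
          using \<open>l 0 = 0\<close> by (cases "k = 0") (simp_all add: algebra_simps)
      qed
      also have "\<dots> = of_real L * (\<Sum>k\<le>n. c k * exp (- (of_real (l k) * s)))
          - of_real L * (\<Sum>k\<le>n. d k * exp (- (of_real (l k) * s))) + 1"
        by (simp add: sum.distrib sum_subtractf sum_distrib_left mult.assoc)
      finally show ?thesis by (simp add: Q_def D_def algebra_simps)
    qed
    ultimately show ?thesis by simp
  qed
  have E_ode: "(E has_field_derivative (of_real L * (Q s - E s))) (at s)" for s
    unfolding E_def by (auto intro!: derivative_eq_intros D_ode simp: algebra_simps)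
  have "norm (E s) \<le> (\<Prod>k=1..Suc n. l k) * norm s ^ Suc (Suc n) / fact (Suc (Suc n)) * exp (l (Suc n) * norm s)" for s
  proof -
    \<comment> \<open>With the integrating factor normalised at \<open>t = 1\<close>, the exponential bounds for the factor and for \<open>Q\<close>
      multiply to \<open>exp (L * norm s)\<close>, independently of \<open>t\<close>.\<close>
    define G where "G = (\<lambda>t::real. exp (- (of_real L * (1 - of_real t) * s)) * E (of_real t * s))"
    define M where "M = L * P * norm s ^ Suc (Suc n) / fact (Suc n) * exp (L * norm s)"
    define \<phi> where "\<phi> = (\<lambda>t::real. M * t ^ Suc (Suc n) / of_nat (Suc (Suc n)))"
    have G': "(G has_vector_derivative
        (s * of_real L * exp (- (of_real L * (1 - of_real t) * s)) * Q (of_real t * s))) (at t)" for t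
    proof -
      have "((\<lambda>z. exp (- (of_real L * (1 - z) * s)) * E (z * s)) has_field_derivative
         (s * of_real L * exp (- (of_real L * (1 - of_real t) * s)) * Q (of_real t * s))) (at (of_real t))"
        by (auto intro!: derivative_eq_intros DERIV_chain2[OF E_ode] simp: algebra_simps)
      from has_vector_derivative_real_field[OF this] show ?thesis by (simp add: G_def)
    qed
    have \<phi>': "(\<phi> has_vector_derivative (M * t ^ Suc n)) (at t)" for t
    proof -
      define m where "m = real (Suc (Suc n))"
      have "((\<lambda>t. t ^ Suc (Suc n)) has_real_derivative m * t ^ Suc n) (at t)"
        using DERIV_pow[of "Suc (Suc n)" t] by (simp add: m_def)
      from DERIV_cdivide[OF DERIV_cmult[OF this, of M], of m]
      have "(\<phi> has_real_derivative M * (m * t ^ Suc n) / m) (at t)"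
        unfolding \<phi>_def m_def .
      moreover have "m \<noteq> 0" by (simp add: m_def)
      ultimately show ?thesis by (simp add: has_real_derivative_iff_has_vector_derivative)
    qed
    have "norm (G 1 - G 0) \<le> \<phi> 1 - \<phi> 0"
    proof (rule differentiable_bound_general[of 0 1 G \<phi>])
      show "continuous_on {0..1} G" "continuous_on {0..1} \<phi>"
        by (rule continuous_on_vector_derivative, rule has_vector_derivative_at_within,
            rule G' \<phi>')+
      fix t :: real assume t: "0 < t" "t < 1"
      have "norm (exp (- (of_real L * (1 - of_real t) * s))) \<le> exp (L * (1 - t) * norm s)"
      proof -
        have "norm (exp (- (of_real L * (1 - of_real t) * s))) \<le> exp (norm (- (of_real L * (1 - of_real t) * s)))"
          by (rule norm_exp)
        also have "norm (- (of_real L * (1 - of_real t) * s)) = L * (1 - t) * norm s"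
        proof -
          have "- (of_real L * (1 - of_real t) * s) = of_real (- (L * (1 - t))) * s" by simp
          then show ?thesis
            using t \<open>L > 0\<close> by (simp only: norm_mult norm_of_real abs_minus_cancel abs_mult)
        qed
        finally show ?thesis .
      qed
      moreover have "norm (Q (of_real t * s)) \<le> P * (t * norm s) ^ Suc n / fact (Suc n) * exp (L * (t * norm s))"
      proof -
        have "norm (Q (of_real t * s)) \<le> P * (t * norm s) ^ Suc n / fact (Suc n) * exp (l n * (t * norm s))"
          using c[of "of_real t * s"] t by (simp add: Q_def norm_mult)
        also have "\<dots> \<le> P * (t * norm s) ^ Suc n / fact (Suc n) * exp (L * (t * norm s))"
          using l_less[of n] t \<open>P \<ge> 0\<close>
          by (intro mult_left_mono divide_nonneg_nonneg mult_nonneg_nonneg) (auto intro!: mult_right_mono)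
        finally show ?thesis .
      qed
      ultimately have "norm (s * of_real L * exp (- (of_real L * (1 - of_real t) * s)) * Q (of_real t * s)) \<le>
          norm s * L * exp (L * (1 - t) * norm s) * (P * (t * norm s) ^ Suc n / fact (Suc n) * exp (L * (t * norm s)))"
        using \<open>L > 0\<close> t \<open>P \<ge> 0\<close> unfolding norm_mult by (intro mult_mono) auto
      also have "\<dots> = M * t ^ Suc n"
      proof -
        have "exp (L * norm s) = exp (L * (1 - t) * norm s) * exp (L * (t * norm s))"
          unfolding exp_add[symmetric] by (simp add: algebra_simps)
        then show ?thesis by (simp add: M_def power_mult_distrib)
      qed
      finally show "norm (s * of_real L * exp (- (of_real L * (1 - of_real t) * s)) * Q (of_real t * s)) \<le> M * t ^ Suc n" .
    qed (simp, rule G', rule \<phi>')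
    moreover have "G 0 = 0" by (simp add: G_def E_def)
    moreover have "G 1 = E s" by (simp add: G_def)
    moreover have "\<phi> 0 = 0" by (simp add: \<phi>_def)
    moreover have "\<phi> 1 = (\<Prod>k=1..Suc n. l k) * norm s ^ Suc (Suc n) / fact (Suc (Suc n)) * exp (l (Suc n) * norm s)"
      by (simp add: \<phi>_def M_def P_def L_def divide_simps)
    ultimately show ?thesis by (simp only: diff_zero)
  qed
  moreover have "E s = s - (\<Sum>k\<le>Suc n. (if k \<le> n then d k else D 0) * exp (- (of_real (l k) * s)))" for s
    by (simp add: E_def D_def L_def)
  ultimately show ?case by (intro exI[of _ "\<lambda>k. if k \<le> n then d k else D 0"]) simp
qed

text \<open>The error bound at the frequencies \<open>ln (k + 1)\<close>. Consecutive terms have a ratio of order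
  \<open>ln n / n\<close>: the factorial outgrows the product of the logarithms.\<close>

lemma log_nodes_error_tendsto_0:
  assumes "R > 0"
  shows "(\<lambda>n. (\<Prod>k=1..n. ln (real (Suc k))) * R ^ Suc n / fact (Suc n) * exp (ln (real (Suc n)) * R)) \<longlonglongrightarrow> 0"
    (is "?a \<longlonglongrightarrow> 0")
proof (rule summable_LIMSEQ_zero)
  have "(\<lambda>n. ln (real n) / real n) \<longlonglongrightarrow> 0" by (rule lim_ln_over_n)
  then have "(\<lambda>n. (R * exp (ln 2 * R)) * (ln (real (n + 2)) / real (n + 2))) \<longlonglongrightarrow> (R * exp (ln 2 * R)) * 0"
    by (intro tendsto_intros LIMSEQ_ignore_initial_segment)
  then have "\<forall>\<^sub>F n in sequentially. (R * exp (ln 2 * R)) * (ln (real (n + 2)) / real (n + 2)) < 1 / 2"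
    by (rule order_tendstoD) simp
  then obtain N where N: "\<And>n. n \<ge> N \<Longrightarrow> (R * exp (ln 2 * R)) * (ln (real (n + 2)) / real (n + 2)) < 1 / 2"
    by (auto simp: eventually_sequentially)
  show "summable ?a"
  proof (rule summable_ratio_test[of "1/2" N])
    fix n assume "N \<le> n"
    define p where "p = (\<Prod>k=1..n. ln (real (Suc k)))"
    have "p \<ge> 0" unfolding p_def by (intro prod_nonneg) auto
    have a0: "?a m \<ge> 0" for m using assms by (intro mult_nonneg_nonneg divide_nonneg_nonneg prod_nonneg) auto
    have "real (n + 2) \<le> 2 * real (Suc n)" by simp
    then have "ln (real (n + 2)) \<le> ln (2 * real (Suc n))" by (subst ln_le_cancel_iff) auto
    also have "\<dots> = ln 2 + ln (real (Suc n))" by (subst ln_mult) auto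
    finally have "exp (ln (real (n + 2)) * R) \<le> exp ((ln 2 + ln (real (Suc n))) * R)"
      using assms by (simp add: mult_right_mono)
    also have "\<dots> = exp (ln 2 * R) * exp (ln (real (Suc n)) * R)" by (simp add: distrib_right exp_add)
    finally have ex: "exp (ln (real (n + 2)) * R) \<le> exp (ln 2 * R) * exp (ln (real (Suc n)) * R)" .
    have "?a (Suc n) = p * ln (real (n + 2)) * (R * R ^ Suc n) / (real (n + 2) * fact (Suc n)) * exp (ln (real (n + 2)) * R)"
      by (simp add: p_def add.commute)
    also have "\<dots> \<le> p * ln (real (n + 2)) * (R * R ^ Suc n) / (real (n + 2) * fact (Suc n)) * (exp (ln 2 * R) * exp (ln (real (Suc n)) * R))"
      using assms \<open>p \<ge> 0\<close> by (intro mult_left_mono ex divide_nonneg_nonneg mult_nonneg_nonneg) auto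
    also have "\<dots> = ((R * exp (ln 2 * R)) * (ln (real (n + 2)) / real (n + 2))) * ?a n"
      by (simp add: p_def)
    also have "\<dots> \<le> 1 / 2 * ?a n"
      using N[OF \<open>N \<le> n\<close>] by (intro mult_right_mono a0) auto
    finally show "norm (?a (Suc n)) \<le> 1 / 2 * norm (?a n)"
      unfolding real_norm_def abs_of_nonneg[OF a0] .
  qed simp
qed

lemma identity_in_dirichlet_closure:
  assumes "compact K"
  shows "(\<lambda>z. z) \<in> dirichlet_closure K"
  unfolding dirichlet_closure_def
proof safe
  fix e :: real assume "e > 0"
  obtain R where R: "R > 0" "\<And>z. z \<in> K \<Longrightarrow> norm z \<le> R"
    using compact_imp_bounded[OF assms] by (auto simp: bounded_pos)
  define l where "l = (\<lambda>k. ln (real (Suc k)))"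
  have l: "strict_mono l" "l 0 = 0" "\<And>k. l k \<ge> 0" by (auto simp: l_def strict_mono_def)
  obtain n where n: "(\<Prod>k=1..n. l k) * R ^ Suc n / fact (Suc n) * exp (l n * R) < e"
    using order_tendstoD(2)[OF log_nodes_error_tendsto_0[OF R(1)] \<open>e > 0\<close>]
    unfolding l_def eventually_sequentially by blast
  obtain c where c: "\<And>s::complex. norm (s - (\<Sum>k\<le>n. c k * exp (- (of_real (l k) * s)))) \<le>
    (\<Prod>k=1..n. l k) * norm s ^ Suc n / fact (Suc n) * exp (l n * norm s)"
    using identity_minus_exponentials[OF l(1,2)] by blast
  show "\<exists>P\<in>dirichlet_polys. \<forall>z\<in>K. norm (z - P z) < e"
  proof (intro bexI ballI)
    fix z assume "z \<in> K"
    have "norm (z - (\<Sum>k\<le>n. c k * exp (- (of_real (l k) * z)))) \<le>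
      (\<Prod>k=1..n. l k) * norm z ^ Suc n / fact (Suc n) * exp (l n * norm z)" by (rule c)
    also have "\<dots> \<le> (\<Prod>k=1..n. l k) * R ^ Suc n / fact (Suc n) * exp (l n * R)"
      using R(2)[OF \<open>z \<in> K\<close>] l(3) R(1)
      by (intro mult_mono divide_right_mono power_mono mult_nonneg_nonneg divide_nonneg_nonneg prod_nonneg)
         (auto intro!: mult_left_mono)
    finally show "norm (z - (\<Sum>k\<le>n. c k * exp (- (of_real (l k) * z)))) < e" using n by linarith
  next
    show "(\<lambda>z. \<Sum>k\<le>n. c k * exp (- (of_real (l k) * z))) \<in> dirichlet_polys"
      unfolding l_def by (intro dirichlet_polys_sum dirichlet_polys_term) auto
  qed
qed

lemma uniformly_closed_algebra_dirichlet_closure: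
  assumes "compact K"
  shows "uniformly_closed_algebra K (dirichlet_closure K)"
proof
  show "(\<lambda>_. c) \<in> dirichlet_closure K" for c
    unfolding dirichlet_closure_def by (auto intro!: bexI[OF _ dirichlet_polys_const[of c]])
  show "(\<lambda>z. z) \<in> dirichlet_closure K" by (rule identity_in_dirichlet_closure[OF assms])
  show "(\<lambda>z. f z + g z) \<in> dirichlet_closure K"
    if "f \<in> dirichlet_closure K" "g \<in> dirichlet_closure K" for f g
    using that by (rule dirichlet_closure_add)
  show "(\<lambda>z. f z * g z) \<in> dirichlet_closure K"
    if "f \<in> dirichlet_closure K" "g \<in> dirichlet_closure K" for f g
    using assms that by (rule dirichlet_closure_mult)
  show "f \<in> dirichlet_closure K"
    if "\<And>e. e > 0 \<Longrightarrow> \<exists>g\<in>dirichlet_closure K. \<forall>z\<in>K. norm (f z - g z) < e" for f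
    using that by (rule dirichlet_closure_closed)
qed (fact assms)

section \<open>Approximation by Dirichlet polynomials\<close>

theorem lemma4p1:
  fixes K :: "complex set" and f :: "complex \<Rightarrow> complex" and \<epsilon> :: real
  assumes "compact K"
    and "connected (- K)"
    and "f \<in> A_space K"
    and "\<epsilon> > 0"
  shows "\<exists>(N::nat) (a::nat \<Rightarrow> complex). sup_norm_on K (\<lambda>s. f s - dirichlet_poly N a s) < \<epsilon>"
proof -
  interpret uniformly_closed_algebra K "dirichlet_closure K"
    by (rule uniformly_closed_algebra_dirichlet_closure[OF assms(1)])
  have "f \<in> dirichlet_closure K"
    using assms(2,3) by (intro mergelyan) (auto simp: A_space_def)
  moreover have "\<epsilon> / 2 > 0" using assms(4) by simp
  ultimately obtain P where "P \<in> dirichlet_polys" and P: "\<And>z. z \<in> K \<Longrightarrow> norm (f z - P z) < \<epsilon> / 2"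
    unfolding dirichlet_closure_def by blast
  then obtain N a where Na: "P = dirichlet_poly N a" by (auto simp: dirichlet_polys_def)
  have "sup_norm_on K (\<lambda>s. f s - dirichlet_poly N a s) \<le> \<epsilon> / 2"
    unfolding sup_norm_on_def
    by (rule cSup_least) (use P \<open>\<epsilon> / 2 > 0\<close> in \<open>auto simp: Na intro: less_imp_le\<close>)
  then have "sup_norm_on K (\<lambda>s. f s - dirichlet_poly N a s) < \<epsilon>" using assms(4) by linarith
  then show ?thesis by blast
qed

end
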